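(* Let $d\ge 1$ be an integer, let $0\le p\le 1$, and let $K:\mathbb{R}_+\to[0,1]$ be a decreasing link probability function with $0<\int_0^\infty u^{d-1}K(u)\,du<\infty$. The $d$-dimensional rectangular latent position network model with $g(n)=n^{p/d}$ and link probability function $K$ is $n^{2-p}$-sparse in expectation.
   Context: $\mathbb{R}_+=[0,\infty)$; "decreasing" means non-increasing. Rectangular latent position model (rectangular LPM): let $g(t)=t^{p/d}$ and for $t>0$ let $$H(t)=[-g(t),g(t)]^d\times\left[0,\frac{t}{(2g(t))^d}\right]\subset\mathbb{R}^d\times\mathbb{R}_+ ,$$ a nested increasing family of observation windows with Lebesgue measure $|H(t)|=t$. Generate a unit-rate Poisson process $\Psi$ on $\mathbb{R}^d\times\mathbb{R}_+$. Each point $(Z,r)\in\Psi$ is a node with latent position $Z\in\mathbb{R}^d$ and auxiliary coordinate $r$. The arrival time of a node $(Z,r)$ is the smallest $t$ with $(Z,r)\in H(t)$. Nodes are numbered $1,2,\dots$ in order of arrival times $t_1<t_2<\cdots$ (almost surely strict). Conditional on $\Psi$, each pair of nodes $i\neq j$ is joined by an edge independently with probability $K(\|Z_i-Z_j\|)$ (Euclidean norm). $Y^n\in\{0,1\}^{n\times n}$ is the (symmetric, zero-diagonal) adjacency matrix of the subgraph induced by the first $n$ nodes to arrive. Sparsity: a sequence of random adjacency matrices $(Y^n)_{n\ge1}$ is $e(n)$-sparse in expectation if $$\lim_{n\to\infty}\mathbb{E}\left(\frac{\sum_{i=1}^n\sum_{j=1}^nY^n_{ij}}{e(n)}\right)=C$$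 for some constant $C\in(0,\infty)$. *)

theory Defs
  imports "HOL-Probability.Probability"
begin

definition point_count :: "'a set \<Rightarrow> 'a set \<Rightarrow> ennreal" where
  "point_count \<phi> B = emeasure (count_space UNIV) (\<phi> \<inter> B)"

text \<open>The sigma-algebra on point configurations generated by the counts of Borel sets.
  Configurations are plain sets: this loses nothing for a Poisson process with a diffuse
  intensity, which is almost surely simple.\<close>

definition configurations :: "'a::topological_space set measure" where
  "configurations =
     sigma UNIV {(\<lambda>\<phi>. point_count \<phi> B) -` S | B S. B \<in> sets borel \<and> S \<in> sets borel}"

definition poisson_process ::
    "'w measure \<Rightarrow> 'a::topological_space measure \<Rightarrow> ('w \<Rightarrow> 'a set) \<Rightarrow> bool" where
  "poisson_process M \<Lambda> \<Psi> \<longleftrightarrow>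
     prob_space M \<and>
     \<Psi> \<in> M \<rightarrow>\<^sub>M configurations \<and>
     (\<forall>B \<in> sets borel. \<forall>k::nat. emeasure \<Lambda> B < \<infinity> \<longrightarrow>
        measure M {\<omega> \<in> space M. point_count (\<Psi> \<omega>) B = of_nat k}
          = exp (- measure \<Lambda> B) * measure \<Lambda> B ^ k / fact k) \<and>
     (\<forall>(J::nat set) B. finite J \<longrightarrow> (\<forall>j \<in> J. B j \<in> sets borel) \<longrightarrow> disjoint_family_on B J \<longrightarrow>
        prob_space.indep_vars M (\<lambda>_. borel) (\<lambda>j \<omega>. point_count (\<Psi> \<omega>) (B j)) J)"

text \<open>Lebesgue measure on \<open>\<real>\<^sup>d \<times> [0, \<infinity>)\<close>, extended by zero, with \<open>d = CARD('d)\<close>.\<close>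

definition unit_rate :: "((real ^ 'd) \<times> real) measure" where
  "unit_rate = density lborel (indicator (UNIV \<times> {0..}))"

definition window :: "(real \<Rightarrow> real) \<Rightarrow> real \<Rightarrow> ((real ^ 'd) \<times> real) set" where
  "window g t = cbox (\<chi> i. - g t) (\<chi> i. g t) \<times> {0 .. t / (2 * g t) ^ CARD('d)}"

definition arrives :: "(real \<Rightarrow> real) \<Rightarrow> (real ^ 'd) \<times> real \<Rightarrow> bool" where
  "arrives g x \<longleftrightarrow> (\<exists>t>0. x \<in> window g t)"

definition arrival_time :: "(real \<Rightarrow> real) \<Rightarrow> (real ^ 'd) \<times> real \<Rightarrow> real" where
  "arrival_time g x = (LEAST t. 0 < t \<and> x \<in> window g t)"

text \<open>Nodes are numbered from 1. The \<open>i\<close>-th node to arrive is the one by whose arrival time exactly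
  \<open>i\<close> nodes have arrived, itself included. Infinite sets have cardinality 0, so for \<open>i \<ge> 1\<close> the
  condition also says that only finitely many nodes have arrived. Points that never enter a
  window (they exist when the exponent of \<open>g\<close> is \<open>1/d\<close>) receive no number.\<close>

definition node :: "(real \<Rightarrow> real) \<Rightarrow> ((real ^ 'd) \<times> real) set \<Rightarrow> nat \<Rightarrow> (real ^ 'd) \<times> real" where
  "node g \<phi> i = (THE x. x \<in> \<phi> \<and> arrives g x \<and>
     card {y \<in> \<phi>. arrives g y \<and> arrival_time g y \<le> arrival_time g x} = i)"

definition latent_position :: "(real \<Rightarrow> real) \<Rightarrow> ((real ^ 'd) \<times> real) set \<Rightarrow> nat \<Rightarrow> real ^ 'd" where
  "latent_position g \<phi> i = fst (node g \<phi> i)"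

text \<open>\<open>G \<omega> i j\<close> says that the \<open>i\<close>-th and the \<open>j\<close>-th node to arrive are joined. The last clause is
  conditional independence of the edges given \<open>\<Psi>\<close>, with the edge probabilities supplied by
  singleton sets \<open>E\<close>.\<close>

definition rectangular_LPM ::
    "'w measure \<Rightarrow> (real \<Rightarrow> real) \<Rightarrow> (real \<Rightarrow> real) \<Rightarrow>
     ('w \<Rightarrow> ((real ^ 'd) \<times> real) set) \<Rightarrow> ('w \<Rightarrow> nat \<Rightarrow> nat \<Rightarrow> bool) \<Rightarrow> bool" where
  "rectangular_LPM M g K \<Psi> G \<longleftrightarrow>
     prob_space M \<and>
     poisson_process M unit_rate \<Psi> \<and>
     (\<forall>\<omega> \<in> space M. \<forall>i j. G \<omega> i j \<longleftrightarrow> G \<omega> j i) \<and>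
     (\<forall>\<omega> \<in> space M. \<forall>i. \<not> G \<omega> i i) \<and>
     (\<forall>i\<ge>1. \<forall>j\<ge>1. {\<omega> \<in> space M. G \<omega> i j} \<in> sets M) \<and>
     (\<forall>E. finite E \<longrightarrow> E \<subseteq> {(i, j). 1 \<le> i \<and> i < j} \<longrightarrow>
        (AE \<omega> in M.
           real_cond_exp M (vimage_algebra (space M) \<Psi> configurations)
             (indicator {\<omega> \<in> space M. \<forall>(i, j) \<in> E. G \<omega> i j}) \<omega>
           = (\<Prod>(i, j) \<in> E. K (norm (latent_position g (\<Psi> \<omega>) i - latent_position g (\<Psi> \<omega>) j)))))"

definition adjacency ::
    "('w \<Rightarrow> nat \<Rightarrow> nat \<Rightarrow> bool) \<Rightarrow> nat \<Rightarrow> 'w \<Rightarrow> nat \<Rightarrow> nat \<Rightarrow> real" where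
  "adjacency G n \<omega> i j = of_bool (i \<in> {1..n} \<and> j \<in> {1..n} \<and> G \<omega> i j)"

definition sparse_in_expectation ::
    "'w measure \<Rightarrow> (nat \<Rightarrow> 'w \<Rightarrow> nat \<Rightarrow> nat \<Rightarrow> real) \<Rightarrow> (nat \<Rightarrow> real) \<Rightarrow> bool" where
  "sparse_in_expectation M Y e \<longleftrightarrow>
     (\<exists>C>0. (\<lambda>n. \<integral>\<omega>. (\<Sum>i=1..n. \<Sum>j=1..n. Y n \<omega> i j) / e n \<partial>M) \<longlonglongrightarrow> C)"

end

theory Submission
  imports Defs "HOL-Real_Asymp.Real_Asymp"
begin

text \<open>Write \<open>S\<^sub>n\<close> for the sum of \<open>K(\<parallel>Z\<^sub>i - Z\<^sub>j\<parallel>)\<close> over the ordered pairs of distinct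
indices up to \<open>n\<close>. Given \<open>\<Psi>\<close>, these are the probabilities of the edges, so the expected
number of nonzero entries of \<open>Y\<^sup>n\<close> is \<open>E S\<^sub>n\<close>. Here the number \<open>n\<close> of nodes is fixed and the observed window
is random. It is easier to fix the time \<open>t\<close> and let the number \<open>N(t)\<close> of nodes in \<open>H(t)\<close> be random: let \<open>S(t)\<close> be the same sum over all pairs of distinct points of
\<open>\<Psi>\<close> in \<open>H(t)\<close>.

The counts of a Poisson process in disjoint sets are independent, so the measure that counts pairs
of distinct points has mean \<open>\<Lambda> \<otimes> \<Lambda>\<close> on rectangles and hence everywhere
(\<open>poisson_pairs_nn_integral\<close>). Therefore \<open>E S(t)\<close> is the double integral of \<open>K(\<parallel>z - z'\<parallel>)\<close> over
\<open>H(t) \<times> H(t)\<close>. With \<open>B\<close> the cube of side \<open>2 t\<^bsup>p/d\<^esup>\<close> and \<open>m(t)\<close> the average over \<open>z \<in> B\<close> of the integral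
of \<open>K(\<parallel>z - z'\<parallel>)\<close> over \<open>z' \<in> B\<close>, this is \<open>t\<^bsup>2 - p\<^esup> m(t) / 2\<^sup>d\<close> (\<open>frame_energy\<close>). If \<open>p = 0\<close>, the
cube does not change and \<open>m\<close> is constant. If \<open>p > 0\<close>, most points of the growing cube are far from its
boundary, and \<open>m(t)\<close> tends to the integral of \<open>K(\<parallel>w\<parallel>)\<close> over \<open>\<real>\<^sup>d\<close>, which is finite by polar
coordinates (\<open>mean_box_mass_limit\<close>).

It remains to compare \<open>S\<^sub>n\<close> with \<open>S(\<theta> n)\<close> for \<open>\<theta>\<close> close to \<open>1\<close>. Both sums run over the nodes in order
of arrival, so \<open>S\<^sub>n \<le> S(t)\<close> if \<open>n \<le> N(t)\<close>, and \<open>S(t) \<le> S\<^sub>n\<close> if \<open>N(t) \<le> n\<close>. On the exceptional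
event the error is at most \<open>n\<^sup>2\<close> or \<open>N(t)\<^sup>2\<close>, and for \<open>t = \<theta> n\<close> and large \<open>n\<close> either one is at most
\<open>n\<^sup>2 \<theta>\<^sup>n (1/\<theta>)\<^bsup>N(t)\<^esup>\<close>. The Poisson generating function gives this bound the mean
\<open>n\<^sup>2 (\<theta> e\<^bsup>1 - \<theta>\<^esup>)\<^sup>n\<close>, which vanishes exponentially fast because \<open>\<theta> e\<^bsup>1 - \<theta>\<^esup> < 1\<close> for \<open>\<theta> \<noteq> 1\<close>
(\<open>expected_pair_sum_bounds\<close>). Letting \<open>\<theta>\<close> tend to \<open>1\<close> from above and from below finishes the
proof (\<open>sandwich_tendsto\<close>).\<close>

section \<open>Moments of the Poisson distribution\<close>

lemma suminf_exp_ennreal: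
  assumes "0 \<le> c" "0 \<le> x"
  shows "(\<Sum>k. ennreal c * ennreal (x ^ k / fact k)) = ennreal (c * exp x)"
proof -
  have "(\<Sum>k. ennreal (x ^ k / fact k)) = ennreal (exp x)"
    using exp_converges[of x] assms
    by (intro suminf_ennreal_eq) (auto simp: divide_inverse mult.commute)
  then show ?thesis
    using assms by (simp add: ennreal_mult)
qed

lemma suminf_ennreal_Suc:
  fixes f :: "nat \<Rightarrow> ennreal"
  shows "(\<Sum>k. f k) = f 0 + (\<Sum>k. f (Suc k))"
  using suminf_offset[of f 1] by (simp add: add.commute)

text \<open>The Poisson weights sum to one, so an extended count with these probabilities is almost surely
finite. The variable \<open>X\<close> is for the cardinality of a random set, which is a natural number also
where the count is infinite.\<close>

lemma poisson_nn_integral: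
  fixes N :: "'w \<Rightarrow> ennreal"
  assumes "prob_space M" and "0 \<le> m"
    and N: "N \<in> borel_measurable M"
    and pmf: "\<And>k. measure M {\<omega> \<in> space M. N \<omega> = of_nat k} = exp (- m) * m ^ k / fact k"
  shows poisson_AE_nat: "AE \<omega> in M. \<exists>k. N \<omega> = of_nat k"
    and "(AE \<omega> in M. N \<omega> = of_nat (X \<omega>)) \<Longrightarrow>
      (\<integral>\<^sup>+\<omega>. h (X \<omega>) \<partial>M) = (\<Sum>k. ennreal (exp (- m) * m ^ k / fact k) * h k)"
proof -
  interpret prob_space M by fact
  define A where "A k = {\<omega> \<in> space M. N \<omega> = of_nat k}" for k :: nat
  have A [measurable]: "A k \<in> sets M" for k
  proof -
    have "{of_nat k :: ennreal} \<in> sets borel"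
      by (rule borel_closed) auto
    from measurable_sets[OF N this] show ?thesis
      by (simp add: A_def vimage_def Int_def conj_commute)
  qed
  have eA: "emeasure M (A k) = ennreal (exp (- m) * m ^ k / fact k)" for k
    using pmf[of k] by (simp add: emeasure_eq_measure A_def)
  have "disjoint_family A"
    by (auto simp: disjoint_family_on_def A_def)
  then have "emeasure M (\<Union>k. A k) = (\<Sum>k. emeasure M (A k))"
    by (subst suminf_emeasure) auto
  also have "\<dots> = (\<Sum>k. ennreal (exp (- m)) * ennreal (m ^ k / fact k))"
    unfolding eA using \<open>0 \<le> m\<close> by (intro suminf_cong) (simp flip: ennreal_mult)
  also have "\<dots> = 1"
    using \<open>0 \<le> m\<close> by (subst suminf_exp_ennreal) (auto simp flip: exp_add)
  finally have "emeasure M (\<Union>k. A k) = 1" .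
  then have "AE \<omega> in M. \<omega> \<in> (\<Union>k. A k)"
    by (intro AE_prob_1) (simp add: measure_def)
  then show "AE \<omega> in M. \<exists>k. N \<omega> = of_nat k"
    by eventually_elim (auto simp: A_def)
  assume X: "AE \<omega> in M. N \<omega> = of_nat (X \<omega>)"
  have "(\<integral>\<^sup>+\<omega>. h (X \<omega>) \<partial>M) = (\<integral>\<^sup>+\<omega>. (\<Sum>k. h k * indicator (A k) \<omega>) \<partial>M)"
  proof (intro nn_integral_cong_AE)
    show "AE \<omega> in M. h (X \<omega>) = (\<Sum>k. h k * indicator (A k) \<omega>)"
      using X AE_space
    proof eventually_elim
      case (elim \<omega>)
      have "(\<Sum>k. h k * indicator (A k) \<omega>) = (\<Sum>k\<in>{X \<omega>}. h k * indicator (A k) \<omega>)"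
        using elim by (intro suminf_finite) (auto simp: A_def indicator_def)
      then show ?case
        using elim by (auto simp: A_def)
    qed
  qed
  also have "\<dots> = (\<Sum>k. emeasure M (A k) * h k)"
    by (simp add: nn_integral_suminf nn_integral_cmult mult.commute)
  finally show "(\<integral>\<^sup>+\<omega>. h (X \<omega>) \<partial>M) = (\<Sum>k. ennreal (exp (- m) * m ^ k / fact k) * h k)"
    unfolding eA .
qed

lemma poisson_generating_function:
  assumes "0 \<le> m" "0 \<le> s"
  shows "(\<Sum>k. ennreal (exp (- m) * m ^ k / fact k) * ennreal (s ^ k)) = ennreal (exp (m * (s - 1)))"
proof -
  have "(\<Sum>k. ennreal (exp (- m) * m ^ k / fact k) * ennreal (s ^ k))
      = (\<Sum>k. ennreal (exp (- m)) * ennreal ((m * s) ^ k / fact k))"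
    using assms by (intro suminf_cong) (simp add: power_mult_distrib flip: ennreal_mult)
  also have "\<dots> = ennreal (exp (- m) * exp (m * s))"
    using assms by (intro suminf_exp_ennreal) auto
  finally show ?thesis
    by (simp add: algebra_simps flip: exp_add)
qed

lemma poisson_mean:
  assumes "0 \<le> m"
  shows "(\<Sum>k. ennreal (exp (- m) * m ^ k / fact k) * of_nat k) = ennreal m"
proof -
  have "(\<Sum>k. ennreal (exp (- m) * m ^ k / fact k) * of_nat k)
    = (\<Sum>k. ennreal (exp (- m) * m ^ Suc k / fact (Suc k)) * of_nat (Suc k))"
    by (subst suminf_ennreal_Suc) simp
  also have "\<dots> = (\<Sum>k. ennreal (exp (- m) * m) * ennreal (m ^ k / fact k))"
    using assms unfolding ennreal_of_nat_eq_real_of_nat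
    by (intro suminf_cong) (simp add: field_simps flip: ennreal_mult del: of_nat_Suc)
  also have "\<dots> = ennreal m"
    using assms by (subst suminf_exp_ennreal) (auto simp: mult.commute mult.left_commute simp flip: exp_add)
  finally show ?thesis .
qed

lemma poisson_second_moment:
  assumes "0 \<le> m"
  shows "(\<Sum>k. ennreal (exp (- m) * m ^ k / fact k) * (of_nat k)\<^sup>2) = ennreal (m\<^sup>2 + m)"
proof -
  have "(\<Sum>k. ennreal (exp (- m) * m ^ k / fact k) * (of_nat k)\<^sup>2)
    = (\<Sum>k. ennreal (exp (- m) * m ^ Suc k / fact (Suc k)) * (of_nat (Suc k))\<^sup>2)"
    by (subst suminf_ennreal_Suc) simp
  also have "\<dots> = (\<Sum>k. ennreal m * (ennreal (exp (- m) * m ^ k / fact k) * of_nat k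
      + ennreal (exp (- m) * m ^ k / fact k) * ennreal (1 ^ k)))"
  proof (intro suminf_cong)
    fix k :: nat
    define r where "r = real (Suc k)"
    have r: "0 < r" "real k = r - 1" by (auto simp: r_def)
    have "exp (- m) * m ^ Suc k / fact (Suc k) * r\<^sup>2
        = m * (exp (- m) * m ^ k / fact k * real k + exp (- m) * m ^ k / fact k)"
      using r(1) unfolding fact_Suc r_def[symmetric] r(2) by (simp add: field_simps power2_eq_square)
    then have "ennreal (exp (- m) * m ^ Suc k / fact (Suc k)) * ennreal (r\<^sup>2)
      = ennreal m * (ennreal (exp (- m) * m ^ k / fact k) * ennreal (real k)
        + ennreal (exp (- m) * m ^ k / fact k))"
      using assms by (simp flip: ennreal_mult ennreal_plus del: fact_Suc power_Suc)
    moreover have "(of_nat (Suc k))\<^sup>2 = ennreal (r\<^sup>2)"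
      unfolding ennreal_of_nat_eq_real_of_nat r_def by (rule ennreal_power) simp
    ultimately show "ennreal (exp (- m) * m ^ Suc k / fact (Suc k)) * (of_nat (Suc k))\<^sup>2
      = ennreal m * (ennreal (exp (- m) * m ^ k / fact k) * of_nat k
        + ennreal (exp (- m) * m ^ k / fact k) * ennreal (1 ^ k))"
      by (simp add: ennreal_of_nat_eq_real_of_nat del: fact_Suc power_Suc of_nat_Suc)
  qed
  also have "\<dots> = ennreal m * ((\<Sum>k. ennreal (exp (- m) * m ^ k / fact k) * of_nat k)
      + (\<Sum>k. ennreal (exp (- m) * m ^ k / fact k) * ennreal (1 ^ k)))"
    by (subst suminf_add) auto
  also have "\<dots> = ennreal m * (ennreal m + 1)"
    using assms by (simp only: poisson_mean poisson_generating_function) simp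
  also have "\<dots> = ennreal (m\<^sup>2 + m)"
    using assms by (simp add: distrib_left power2_eq_square ennreal_mult)
  finally show ?thesis .
qed

section \<open>Pairs of distinct points of a Poisson process\<close>

text \<open>Campbell's formula for a finite random set. For the indicator of a set \<open>A\<close> both sides are measures in
\<open>A\<close>, so agreement on an intersection-stable generator extends by Dynkin's argument and then to all
functions by monotone approximation. Finiteness of \<open>D\<close> serves the step to complements, where counts
are subtracted.\<close>

lemma nn_integral_finite_random_sum:
  fixes D :: "'w \<Rightarrow> 'b set" and \<mu> :: "'b measure"
  assumes M: "prob_space M"
    and E: "Int_stable E" "E \<subseteq> Pow (space \<mu>)" "space \<mu> \<in> E" "sets \<mu> = sigma_sets (space \<mu>) E"
    and \<mu>: "emeasure \<mu> (space \<mu>) < \<infinity>"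
    and D: "\<And>\<omega>. \<omega> \<in> space M \<Longrightarrow> finite (D \<omega>)" "\<And>\<omega>. \<omega> \<in> space M \<Longrightarrow> D \<omega> \<subseteq> space \<mu>"
    and meas: "\<And>A. A \<in> E \<Longrightarrow> (\<lambda>\<omega>. of_nat (card (D \<omega> \<inter> A)) :: ennreal) \<in> borel_measurable M"
    and int: "\<And>A. A \<in> E \<Longrightarrow> (\<integral>\<^sup>+\<omega>. of_nat (card (D \<omega> \<inter> A)) \<partial>M) = emeasure \<mu> A"
    and f: "f \<in> borel_measurable \<mu>"
  shows "(\<lambda>\<omega>. \<Sum>x\<in>D \<omega>. f x) \<in> borel_measurable M"
    and "(\<integral>\<^sup>+\<omega>. (\<Sum>x\<in>D \<omega>. f x) \<partial>M) = (\<integral>\<^sup>+x. f x \<partial>\<mu>)"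
proof -
  interpret prob_space M by fact
  define c where "c A \<omega> = emeasure (count_space (D \<omega>)) (A \<inter> D \<omega>)" for A \<omega>
  have c_card: "c A \<omega> = of_nat (card (D \<omega> \<inter> A))" if "\<omega> \<in> space M" for A \<omega>
    using D(1)[OF that] by (simp add: c_def emeasure_count_space_finite Int_commute)
  have sets: "c A \<in> borel_measurable M \<and> (\<integral>\<^sup>+\<omega>. c A \<omega> \<partial>M) = emeasure \<mu> A" if "A \<in> sets \<mu>" for A
    using E(1,2) that[unfolded E(4)]
  proof (induction rule: sigma_sets_induct_disjoint)
    case (basic A)
    then show ?case
      using meas[OF basic] int[OF basic] c_card
      by (simp cong: measurable_cong nn_integral_cong)
  next
    case empty
    then show ?case by (simp add: c_def)
  next
    case (compl A)
    have sp: "c (space \<mu>) \<in> borel_measurable M \<and> (\<integral>\<^sup>+\<omega>. c (space \<mu>) \<omega> \<partial>M) = emeasure \<mu> (space \<mu>)"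
      using meas[OF E(3)] int[OF E(3)] c_card
      by (simp cong: measurable_cong nn_integral_cong)
    have split: "c (space \<mu> - A) \<omega> = c (space \<mu>) \<omega> - c A \<omega>" if "\<omega> \<in> space M" for \<omega>
    proof -
      have "D \<omega> \<inter> (space \<mu> - A) = (D \<omega> \<inter> space \<mu>) - (D \<omega> \<inter> A)"
        using D(2)[OF that] by auto
      moreover have "D \<omega> \<inter> A \<subseteq> D \<omega> \<inter> space \<mu>"
        using D(2)[OF that] by auto
      ultimately have "card (D \<omega> \<inter> (space \<mu> - A)) = card (D \<omega> \<inter> space \<mu>) - card (D \<omega> \<inter> A)"
        using D(1)[OF that] by (simp add: card_Diff_subset)
      moreover have "card (D \<omega> \<inter> A) \<le> card (D \<omega> \<inter> space \<mu>)"
        using D[OF that] by (intro card_mono) auto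
      ultimately show ?thesis
        using c_card[OF that]
        by (simp add: ennreal_of_nat_eq_real_of_nat of_nat_diff ennreal_minus)
    qed
    have A: "A \<in> sets \<mu>" using compl E(4) by simp
    have "(\<integral>\<^sup>+\<omega>. c (space \<mu> - A) \<omega> \<partial>M) = (\<integral>\<^sup>+\<omega>. c (space \<mu>) \<omega> - c A \<omega> \<partial>M)"
      by (intro nn_integral_cong split)
    also have "\<dots> = emeasure \<mu> (space \<mu>) - emeasure \<mu> A"
    proof (subst nn_integral_diff)
      show "AE \<omega> in M. c A \<omega> \<le> c (space \<mu>) \<omega>"
      proof (intro AE_I2)
        fix \<omega> assume "\<omega> \<in> space M"
        then show "c A \<omega> \<le> c (space \<mu>) \<omega>"
          using D[of \<omega>] c_card by (auto intro!: card_mono)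
      qed
    qed (use sp compl \<mu> emeasure_space[of \<mu> A] in \<open>auto simp: top_unique less_top\<close>)
    also have "\<dots> = emeasure \<mu> (space \<mu> - A)"
      using A \<mu> emeasure_space[of \<mu> A] by (subst emeasure_compl) (auto simp: top_unique less_top)
    finally have "(\<integral>\<^sup>+\<omega>. c (space \<mu> - A) \<omega> \<partial>M) = emeasure \<mu> (space \<mu> - A)" .
    moreover have "c (space \<mu> - A) \<in> borel_measurable M"
    proof (subst measurable_cong[OF split])
      have "c (space \<mu>) \<in> borel_measurable M" "c A \<in> borel_measurable M"
        using sp compl by blast+
      then show "(\<lambda>\<omega>. c (space \<mu>) \<omega> - c A \<omega>) \<in> borel_measurable M"
        by (rule borel_measurable_minus_ennreal)
    qed
    ultimately show ?case
      by simp
  next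
    case (union A)
    have split: "c (\<Union>i. A i) \<omega> = (\<Sum>i. c (A i) \<omega>)" for \<omega>
    proof -
      have "disjoint_family (\<lambda>i. A i \<inter> D \<omega>)"
        using union(1) by (auto simp: disjoint_family_on_def)
      then show ?thesis
        unfolding c_def by (subst suminf_emeasure) auto
    qed
    have "range A \<subseteq> sets \<mu>" using union E(4) by simp
    then show ?case
      using union unfolding split[abs_def]
      by (auto simp: nn_integral_suminf suminf_emeasure intro!: borel_measurable_suminf_order)
  qed
  let ?F = "\<lambda>f \<omega>. \<integral>\<^sup>+x. f x \<partial>count_space (D \<omega>)"
  have main: "?F f \<in> borel_measurable M \<and> (\<integral>\<^sup>+\<omega>. ?F f \<omega> \<partial>M) = (\<integral>\<^sup>+x. f x \<partial>\<mu>)"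
    using f
  proof (induct rule: borel_measurable_induct)
    case (cong f g)
    have "?F f \<omega> = ?F g \<omega>" if "\<omega> \<in> space M" for \<omega>
      using cong(3) D(2)[OF that] by (intro nn_integral_cong) auto
    moreover have "(\<integral>\<^sup>+x. f x \<partial>\<mu>) = (\<integral>\<^sup>+x. g x \<partial>\<mu>)"
      using cong(3) by (rule nn_integral_cong)
    ultimately show ?case
      using cong(4) by (simp cong: measurable_cong nn_integral_cong)
  next
    case (set A)
    have "?F (indicator A) = c A"
    proof
      fix \<omega>
      have "?F (indicator A) \<omega> = ?F (indicator (A \<inter> D \<omega>)) \<omega>"
        by (intro nn_integral_cong) (auto simp: indicator_def)
      then show "?F (indicator A) \<omega> = c A \<omega>" by (simp add: c_def)
    qed
    then show ?case
      using sets[OF set] set by simp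
  next
    case (mult u c)
    then show ?case
      by (auto simp: nn_integral_cmult intro!: borel_measurable_times_ennreal)
  next
    case (add u v)
    then show ?case
      by (auto simp: nn_integral_add intro!: borel_measurable_add)
  next
    case (seq U)
    have "?F (SUP i. U i) \<omega> = (SUP i. ?F (U i) \<omega>)" for \<omega>
      using seq(4) unfolding SUP_apply by (intro nn_integral_monotone_convergence_SUP) auto
    moreover have "incseq (\<lambda>i \<omega>. ?F (U i) \<omega>)"
      using seq(4) by (auto simp: incseq_def le_fun_def intro!: nn_integral_mono)
    then have "(\<integral>\<^sup>+\<omega>. (SUP i. ?F (U i) \<omega>) \<partial>M) = (SUP i. \<integral>\<^sup>+\<omega>. ?F (U i) \<omega> \<partial>M)"
      using seq(3) by (intro nn_integral_monotone_convergence_SUP) auto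
    moreover have "(\<integral>\<^sup>+x. (SUP i. U i) x \<partial>\<mu>) = (SUP i. \<integral>\<^sup>+x. U i x \<partial>\<mu>)"
      using seq(1,4) unfolding SUP_apply by (intro nn_integral_monotone_convergence_SUP) auto
    ultimately show ?case
      using seq(3) by (auto intro!: borel_measurable_SUP)
  qed
  have eq: "(\<Sum>x\<in>D \<omega>. f x) = ?F f \<omega>" if "\<omega> \<in> space M" for \<omega>
    using D(1)[OF that] by (simp add: nn_integral_count_space_finite)
  show "(\<lambda>\<omega>. \<Sum>x\<in>D \<omega>. f x) \<in> borel_measurable M"
    using main eq by (simp cong: measurable_cong)
  show "(\<integral>\<^sup>+\<omega>. (\<Sum>x\<in>D \<omega>. f x) \<partial>M) = (\<integral>\<^sup>+x. f x \<partial>\<mu>)"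
    using main eq by (simp cong: nn_integral_cong)
qed

lemma point_count_measurable:
  assumes "\<Psi> \<in> M \<rightarrow>\<^sub>M configurations" "B \<in> sets borel"
  shows "(\<lambda>\<omega>. point_count (\<Psi> \<omega>) B) \<in> borel_measurable M"
proof (rule measurable_compose[OF assms(1)])
  show "(\<lambda>\<phi>. point_count \<phi> B) \<in> borel_measurable configurations"
    unfolding configurations_def
    by (rule measurableI) (use assms(2) in \<open>auto intro!: sigma_sets.Basic\<close>)
qed

lemma point_count_Un:
  assumes "A \<inter> B = {}"
  shows "point_count \<phi> (A \<union> B) = point_count \<phi> A + point_count \<phi> B"
  unfolding point_count_def Int_Un_distrib
  by (intro plus_emeasure[symmetric]) (use assms in auto)

lemma point_count_finite: "finite (\<phi> \<inter> B) \<Longrightarrow> point_count \<phi> B = of_nat (card (\<phi> \<inter> B))"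
  by (simp add: point_count_def)

lemma point_count_less_top: "point_count \<phi> B < top \<longleftrightarrow> finite (\<phi> \<inter> B)"
  by (auto simp: point_count_def emeasure_count_space of_nat_less_top)

text \<open>An infinite set has no pairs by convention. The set of pairs is then always finite, also on the null
event where a bounded window contains infinitely many points.\<close>

definition distinct_pairs :: "'a set \<Rightarrow> ('a \<times> 'a) set" where
  "distinct_pairs A = (if finite A then {(x, y). x \<in> A \<and> y \<in> A \<and> x \<noteq> y} else {})"

lemma finite_distinct_pairs: "finite (distinct_pairs A)"
  by (auto simp: distinct_pairs_def intro: finite_subset[of _ "A \<times> A"])

lemma distinct_pairs_mono: "A \<subseteq> B \<Longrightarrow> finite B \<Longrightarrow> distinct_pairs A \<subseteq> distinct_pairs B"
  by (auto simp: distinct_pairs_def dest: finite_subset)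

lemma card_distinct_pairs_le: "card (distinct_pairs A) \<le> (card A)\<^sup>2"
proof (cases "finite A")
  case True
  then have "card (distinct_pairs A) \<le> card (A \<times> A)"
    by (intro card_mono) (auto simp: distinct_pairs_def)
  then show ?thesis by (simp add: card_cartesian_product power2_eq_square)
qed (simp add: distinct_pairs_def)

lemma bij_betw_distinct_pairs:
  assumes "bij_betw h A B"
  shows "bij_betw (map_prod h h) (distinct_pairs A) (distinct_pairs B)"
proof (rule bij_betw_imageI)
  show "inj_on (map_prod h h) (distinct_pairs A)"
    using assms by (auto simp: inj_on_def distinct_pairs_def bij_betw_def)
  have fin: "finite A \<longleftrightarrow> finite B"
    using assms by (rule bij_betw_finite)
  show "map_prod h h ` distinct_pairs A = distinct_pairs B"
  proof (intro set_eqI iffI)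
    fix z assume "z \<in> map_prod h h ` distinct_pairs A"
    then show "z \<in> distinct_pairs B"
      using assms fin by (auto simp: distinct_pairs_def bij_betw_def inj_on_def split: if_splits)
  next
    fix z assume z: "z \<in> distinct_pairs B"
    then obtain x y where "x \<in> A" "y \<in> A" "z = (h x, h y)"
      using assms by (auto simp: distinct_pairs_def bij_betw_def split: if_splits)
    then show "z \<in> map_prod h h ` distinct_pairs A"
      using z fin by (auto simp: distinct_pairs_def intro!: image_eqI[of _ _ "(x, y)"] split: if_splits)
  qed
qed

text \<open>The pairs in a rectangle are a product with its diagonal removed, which expresses their number by
three counts of single points and so reduces pairs to the defining data of a point process.\<close>

lemma card_distinct_pairs_rectangle:
  assumes "finite A"
  shows "card (distinct_pairs A \<inter> B \<times> C) = card (A \<inter> B) * card (A \<inter> C) - card (A \<inter> (B \<inter> C))"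
proof -
  have "distinct_pairs A \<inter> B \<times> C = (A \<inter> B) \<times> (A \<inter> C) - (\<lambda>x. (x, x)) ` (A \<inter> (B \<inter> C))"
    using assms by (auto simp: distinct_pairs_def)
  moreover have "card ((\<lambda>x. (x, x)) ` (A \<inter> (B \<inter> C))) = card (A \<inter> (B \<inter> C))"
    by (intro card_image) (auto simp: inj_on_def)
  ultimately show ?thesis
    using assms by (simp add: card_Diff_subset image_subset_iff card_cartesian_product)
qed

lemma card_Int_le_mult:
  assumes "finite A"
  shows "card (A \<inter> (B \<inter> C)) \<le> card (A \<inter> B) * card (A \<inter> C)"
proof -
  have "card ((\<lambda>x. (x, x)) ` (A \<inter> (B \<inter> C))) \<le> card ((A \<inter> B) \<times> (A \<inter> C))"
    using assms by (intro card_mono) auto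
  moreover have "card ((\<lambda>x. (x, x)) ` (A \<inter> (B \<inter> C))) = card (A \<inter> (B \<inter> C))"
    by (intro card_image) (auto simp: inj_on_def)
  ultimately show ?thesis
    by (simp add: card_cartesian_product)
qed

lemma of_nat_diff_ennreal: "k \<le> n \<Longrightarrow> (of_nat (n - k) :: ennreal) = of_nat n - of_nat k"
  by (simp add: ennreal_of_nat_eq_real_of_nat of_nat_diff ennreal_minus)

context
  fixes M :: "'w measure" and \<Lambda> :: "'a::topological_space measure" and \<Psi> :: "'w \<Rightarrow> 'a set"
  assumes poisson: "poisson_process M \<Lambda> \<Psi>"
begin

interpretation prob_space M
  using poisson by (simp add: poisson_process_def)

lemma poisson_count_measurable [measurable]:
  "B \<in> sets borel \<Longrightarrow> (\<lambda>\<omega>. point_count (\<Psi> \<omega>) B) \<in> borel_measurable M"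
  using poisson by (auto simp: poisson_process_def intro: point_count_measurable)

lemma poisson_count_AE_finite:
  assumes "B \<in> sets borel" "emeasure \<Lambda> B < \<infinity>"
  shows "AE \<omega> in M. finite (\<Psi> \<omega> \<inter> B)"
proof -
  have "AE \<omega> in M. \<exists>k. point_count (\<Psi> \<omega>) B = of_nat k"
    using poisson assms
    by (intro poisson_AE_nat[OF prob_space_axioms measure_nonneg[of \<Lambda> B]])
       (auto simp: poisson_process_def intro: point_count_measurable)
  then show ?thesis
    by eventually_elim (metis point_count_less_top of_nat_less_top)
qed

lemma poisson_count_nn_integral:
  assumes "B \<in> sets borel" "emeasure \<Lambda> B < \<infinity>"
  shows "(\<integral>\<^sup>+\<omega>. h (card (\<Psi> \<omega> \<inter> B)) \<partial>M) =
    (\<Sum>k. ennreal (exp (- measure \<Lambda> B) * measure \<Lambda> B ^ k / fact k) * h k)"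
proof (rule poisson_nn_integral(2)[OF prob_space_axioms measure_nonneg])
  show "AE \<omega> in M. point_count (\<Psi> \<omega>) B = of_nat (card (\<Psi> \<omega> \<inter> B))"
    using poisson_count_AE_finite[OF assms] by eventually_elim (rule point_count_finite)
qed (use poisson assms in \<open>auto simp: poisson_process_def intro: point_count_measurable\<close>)

lemma poisson_count_mean:
  assumes "B \<in> sets borel" "emeasure \<Lambda> B < \<infinity>"
  shows "(\<integral>\<^sup>+\<omega>. point_count (\<Psi> \<omega>) B \<partial>M) = emeasure \<Lambda> B"
proof -
  have "(\<integral>\<^sup>+\<omega>. point_count (\<Psi> \<omega>) B \<partial>M) = (\<integral>\<^sup>+\<omega>. of_nat (card (\<Psi> \<omega> \<inter> B)) \<partial>M)"
    using poisson_count_AE_finite[OF assms]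
    by (intro nn_integral_cong_AE) (auto elim!: eventually_mono simp: point_count_finite)
  also have "\<dots> = ennreal (measure \<Lambda> B)"
    unfolding poisson_count_nn_integral[OF assms, of of_nat] by (rule poisson_mean) simp
  also have "\<dots> = emeasure \<Lambda> B"
    using assms(2) by (intro emeasure_eq_ennreal_measure[symmetric]) auto
  finally show ?thesis .
qed

lemma poisson_count_second_moment:
  assumes "B \<in> sets borel" "emeasure \<Lambda> B < \<infinity>"
  shows "(\<integral>\<^sup>+\<omega>. (point_count (\<Psi> \<omega>) B)\<^sup>2 \<partial>M) = (emeasure \<Lambda> B)\<^sup>2 + emeasure \<Lambda> B"
proof -
  have "(\<integral>\<^sup>+\<omega>. (point_count (\<Psi> \<omega>) B)\<^sup>2 \<partial>M) = (\<integral>\<^sup>+\<omega>. (of_nat (card (\<Psi> \<omega> \<inter> B)))\<^sup>2 \<partial>M)"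
    using poisson_count_AE_finite[OF assms]
    by (intro nn_integral_cong_AE) (auto elim!: eventually_mono simp: point_count_finite)
  also have "\<dots> = ennreal ((measure \<Lambda> B)\<^sup>2 + measure \<Lambda> B)"
    unfolding poisson_count_nn_integral[OF assms, of "\<lambda>k. (of_nat k)\<^sup>2"]
    by (rule poisson_second_moment) simp
  also have "\<dots> = (ennreal (measure \<Lambda> B))\<^sup>2 + ennreal (measure \<Lambda> B)"
    by (simp add: ennreal_power)
  also have "ennreal (measure \<Lambda> B) = emeasure \<Lambda> B"
    using assms(2) by (intro emeasure_eq_ennreal_measure[symmetric]) auto
  finally show ?thesis .
qed

lemma poisson_count_mult_disjoint:
  assumes "A \<in> sets borel" "emeasure \<Lambda> A < \<infinity>" "B \<in> sets borel" "emeasure \<Lambda> B < \<infinity>" "A \<inter> B = {}"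
  shows "(\<integral>\<^sup>+\<omega>. point_count (\<Psi> \<omega>) A * point_count (\<Psi> \<omega>) B \<partial>M) = emeasure \<Lambda> A * emeasure \<Lambda> B"
proof -
  define C where "C j = (if j = 0 then A else B)" for j :: nat
  have "indep_vars (\<lambda>_. borel) (\<lambda>j \<omega>. point_count (\<Psi> \<omega>) (C j)) {0, 1}"
  proof -
    have "finite {0, 1 :: nat}" "\<forall>j\<in>{0, 1}. C j \<in> sets borel" "disjoint_family_on C {0, 1}"
      using assms by (auto simp: C_def disjoint_family_on_def)
    then show ?thesis
      using poisson unfolding poisson_process_def by blast
  qed
  then have "(\<integral>\<^sup>+\<omega>. (\<Prod>j\<in>{0, 1}. point_count (\<Psi> \<omega>) (C j)) \<partial>M)
      = (\<Prod>j\<in>{0, 1}. \<integral>\<^sup>+\<omega>. point_count (\<Psi> \<omega>) (C j) \<partial>M)"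
    by (intro indep_vars_nn_integral) auto
  then show ?thesis
    using assms by (simp add: C_def poisson_count_mean)
qed

text \<open>Split \<open>A\<close> and \<open>B\<close> into \<open>A - B\<close>, \<open>B - A\<close> and \<open>A \<inter> B\<close>. The mixed products factorise by
independence, and the square of the common count has the extra term \<open>\<Lambda>(A \<inter> B)\<close> because the variance of
a Poisson variable equals its mean.\<close>

lemma poisson_count_mult:
  assumes A: "A \<in> sets borel" "emeasure \<Lambda> A < \<infinity>" and B: "B \<in> sets borel" "emeasure \<Lambda> B < \<infinity>"
    and sets: "sets \<Lambda> = sets borel"
  shows "(\<integral>\<^sup>+\<omega>. point_count (\<Psi> \<omega>) A * point_count (\<Psi> \<omega>) B \<partial>M)
    = emeasure \<Lambda> A * emeasure \<Lambda> B + emeasure \<Lambda> (A \<inter> B)"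
proof -
  define U V W where "U = A - B" and "V = B - A" and "W = A \<inter> B"
  have UVW [measurable]: "U \<in> sets borel" "V \<in> sets borel" "W \<in> sets borel"
    using A B by (auto simp: U_def V_def W_def)
  have "emeasure \<Lambda> C < \<infinity>" if "C \<subseteq> A \<or> C \<subseteq> B" for C
    using that emeasure_mono[of C A \<Lambda>] emeasure_mono[of C B \<Lambda>] A B sets
    by (auto intro: le_less_trans)
  then have fin: "emeasure \<Lambda> U < \<infinity>" "emeasure \<Lambda> V < \<infinity>" "emeasure \<Lambda> W < \<infinity>"
    by (auto simp: U_def V_def W_def)
  have disj: "U \<inter> W = {}" "W \<inter> V = {}" "U \<inter> V = {}" "V \<inter> W = {}"
    by (auto simp: U_def V_def W_def)
  have un: "A = U \<union> W" "B = V \<union> W"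
    by (auto simp: U_def V_def W_def)
  have "(\<integral>\<^sup>+\<omega>. point_count (\<Psi> \<omega>) A * point_count (\<Psi> \<omega>) B \<partial>M) =
      (\<integral>\<^sup>+\<omega>. (point_count (\<Psi> \<omega>) U * point_count (\<Psi> \<omega>) V + point_count (\<Psi> \<omega>) U * point_count (\<Psi> \<omega>) W)
        + (point_count (\<Psi> \<omega>) W * point_count (\<Psi> \<omega>) V + (point_count (\<Psi> \<omega>) W)\<^sup>2) \<partial>M)"
    unfolding un using disj
    by (intro nn_integral_cong) (simp add: point_count_Un algebra_simps power2_eq_square)
  also have "\<dots> = (emeasure \<Lambda> U * emeasure \<Lambda> V + emeasure \<Lambda> U * emeasure \<Lambda> W)
      + (emeasure \<Lambda> W * emeasure \<Lambda> V + ((emeasure \<Lambda> W)\<^sup>2 + emeasure \<Lambda> W))"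
    using UVW fin disj
    by (simp add: nn_integral_add poisson_count_mult_disjoint poisson_count_second_moment)
  also have "\<dots> = (emeasure \<Lambda> U + emeasure \<Lambda> W) * (emeasure \<Lambda> V + emeasure \<Lambda> W) + emeasure \<Lambda> W"
    by (simp add: algebra_simps power2_eq_square)
  also have "\<dots> = emeasure \<Lambda> A * emeasure \<Lambda> B + emeasure \<Lambda> W"
    unfolding un using UVW disj by (subst (1 2) plus_emeasure) (auto simp: sets)
  finally show ?thesis by (simp add: W_def)
qed

lemma poisson_card_measurable:
  assumes "B \<in> sets borel"
  shows "(\<lambda>\<omega>. card (\<Psi> \<omega> \<inter> B)) \<in> M \<rightarrow>\<^sub>M count_space UNIV"
proof -
  note [measurable] = poisson_count_measurable[OF assms]
  have "card (\<Psi> \<omega> \<inter> B) = nat \<lfloor>if point_count (\<Psi> \<omega>) B < top then enn2real (point_count (\<Psi> \<omega>) B) else 0\<rfloor>" for \<omega>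
    by (auto simp: point_count_less_top point_count_finite ennreal_of_nat_eq_real_of_nat)
  then show ?thesis by simp
qed

text \<open>The second factorial moment measure of a Poisson process is \<open>\<Lambda> \<otimes> \<Lambda>\<close>. On rectangles the diagonal
that is left out of the pairs is the term \<open>\<Lambda>(A \<inter> B)\<close> of \<open>poisson_count_mult\<close>, so the two
cancel.\<close>

lemma poisson_pairs_nn_integral:
  assumes H: "H \<in> sets borel" "emeasure \<Lambda> H < \<infinity>" and sets: "sets \<Lambda> = sets borel"
    and f: "f \<in> borel_measurable (\<Lambda> \<Otimes>\<^sub>M \<Lambda>)"
  shows poisson_pairs_measurable: "(\<lambda>\<omega>. \<Sum>z\<in>distinct_pairs (\<Psi> \<omega> \<inter> H). f z) \<in> borel_measurable M"
    and "(\<integral>\<^sup>+\<omega>. (\<Sum>z\<in>distinct_pairs (\<Psi> \<omega> \<inter> H). f z) \<partial>M)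
      = (\<integral>\<^sup>+x\<in>H. (\<integral>\<^sup>+y\<in>H. f (x, y) \<partial>\<Lambda>) \<partial>\<Lambda>)"
proof -
  define \<rho> where "\<rho> = density \<Lambda> (indicator H)"
  have [measurable_cong]: "sets \<rho> = sets borel" "sets \<Lambda> = sets borel"
    by (simp_all add: \<rho>_def sets)
  have H' [measurable]: "H \<in> sets \<Lambda>" using H sets by simp
  have space: "space \<rho> = UNIV" "space \<Lambda> = UNIV"
    using sets sets_eq_imp_space_eq[of \<Lambda> borel] by (simp_all add: \<rho>_def)
  have \<rho>: "emeasure \<rho> A = emeasure \<Lambda> (A \<inter> H)" if "A \<in> sets borel" for A
    using that sets H' by (simp add: \<rho>_def emeasure_density Int_commute flip: indicator_inter_arith)
  interpret \<rho>: finite_measure \<rho>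
    using H \<rho>[of UNIV] by (intro finite_measureI) (simp add: space)
  interpret \<rho>\<rho>: pair_sigma_finite \<rho> \<rho> ..
  have fin_pair: "emeasure (\<rho> \<Otimes>\<^sub>M \<rho>) (space (\<rho> \<Otimes>\<^sub>M \<rho>)) < \<infinity>"
    using H \<rho>[of UNIV] unfolding space_pair_measure
    by (subst \<rho>.emeasure_pair_measure_Times) (auto simp: space sets ennreal_mult_less_top)
  define E where "E = {A \<times> B | A B. A \<in> sets \<rho> \<and> B \<in> sets \<rho>}"
  let ?N = "\<lambda>B \<omega>. point_count (\<Psi> \<omega>) B"
  have count: "of_nat (card (distinct_pairs (\<Psi> \<omega> \<inter> H) \<inter> A \<times> B)) =
      (if ?N H \<omega> < top then ?N (H \<inter> A) \<omega> * ?N (H \<inter> B) \<omega> - ?N (H \<inter> (A \<inter> B)) \<omega> else 0)" for A B \<omega>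
  proof (cases "finite (\<Psi> \<omega> \<inter> H)")
    case True
    then have fin: "finite (\<Psi> \<omega> \<inter> (H \<inter> C))" for C
      by (rule rev_finite_subset) auto
    have "card (\<Psi> \<omega> \<inter> (H \<inter> (A \<inter> B))) \<le> card (\<Psi> \<omega> \<inter> (H \<inter> A)) * card (\<Psi> \<omega> \<inter> (H \<inter> B))"
      using card_Int_le_mult[OF True, of A B] by (simp add: Int_assoc)
    then have "of_nat (card (\<Psi> \<omega> \<inter> (H \<inter> A)) * card (\<Psi> \<omega> \<inter> (H \<inter> B)) - card (\<Psi> \<omega> \<inter> (H \<inter> (A \<inter> B))))
      = ?N (H \<inter> A) \<omega> * ?N (H \<inter> B) \<omega> - ?N (H \<inter> (A \<inter> B)) \<omega>"
      using fin by (simp add: point_count_finite of_nat_diff_ennreal)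
    then show ?thesis
      using True by (simp add: point_count_less_top card_distinct_pairs_rectangle Int_assoc)
  qed (simp add: point_count_less_top distinct_pairs_def)
  note main = nn_integral_finite_random_sum[OF prob_space_axioms, where \<mu> = "\<rho> \<Otimes>\<^sub>M \<rho>" and E = E
      and D = "\<lambda>\<omega>. distinct_pairs (\<Psi> \<omega> \<inter> H)" and f = f]
  have meas: "(\<lambda>\<omega>. of_nat (card (distinct_pairs (\<Psi> \<omega> \<inter> H) \<inter> A)) :: ennreal) \<in> borel_measurable M"
    if "A \<in> E" for A
    using that H(1) unfolding E_def by (auto simp: count \<rho>_def sets)
  have int: "(\<integral>\<^sup>+\<omega>. of_nat (card (distinct_pairs (\<Psi> \<omega> \<inter> H) \<inter> A)) \<partial>M) = emeasure (\<rho> \<Otimes>\<^sub>M \<rho>) A"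
    if "A \<in> E" for A
  proof -
    obtain B C where A: "A = B \<times> C" and [measurable]: "B \<in> sets borel" "C \<in> sets borel"
      using \<open>A \<in> E\<close> by (auto simp: E_def \<rho>_def sets)
    have [measurable]: "H \<in> sets borel" by fact
    have fin: "emeasure \<Lambda> (H \<inter> C) < \<infinity>" for C
      by (rule le_less_trans[OF emeasure_mono H(2)]) (auto simp: H')
    have AE: "AE \<omega> in M. finite (\<Psi> \<omega> \<inter> H)"
      using H by (rule poisson_count_AE_finite)
    have "(\<integral>\<^sup>+\<omega>. of_nat (card (distinct_pairs (\<Psi> \<omega> \<inter> H) \<inter> A)) \<partial>M)
      = (\<integral>\<^sup>+\<omega>. ?N (H \<inter> B) \<omega> * ?N (H \<inter> C) \<omega> - ?N (H \<inter> (B \<inter> C)) \<omega> \<partial>M)"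
      unfolding A count using AE
      by (intro nn_integral_cong_AE) (auto elim!: eventually_mono simp: point_count_less_top)
    also have "\<dots> = (\<integral>\<^sup>+\<omega>. ?N (H \<inter> B) \<omega> * ?N (H \<inter> C) \<omega> \<partial>M) - (\<integral>\<^sup>+\<omega>. ?N (H \<inter> (B \<inter> C)) \<omega> \<partial>M)"
    proof (rule nn_integral_diff)
      show "(\<integral>\<^sup>+\<omega>. ?N (H \<inter> (B \<inter> C)) \<omega> \<partial>M) \<noteq> \<infinity>"
        using fin[of "B \<inter> C"] by (subst poisson_count_mean) auto
      show "AE \<omega> in M. ?N (H \<inter> (B \<inter> C)) \<omega> \<le> ?N (H \<inter> B) \<omega> * ?N (H \<inter> C) \<omega>"
        using AE
      proof eventually_elim
        case (elim \<omega>)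
        have "finite (\<Psi> \<omega> \<inter> (H \<inter> D))" for D
          by (rule finite_subset[OF _ elim]) auto
        then show ?case
          using card_Int_le_mult[OF elim, of B C]
          by (simp add: point_count_finite Int_assoc flip: of_nat_mult)
      qed
    qed measurable
    also have "\<dots> = emeasure \<Lambda> (H \<inter> B) * emeasure \<Lambda> (H \<inter> C) + emeasure \<Lambda> (H \<inter> (B \<inter> C)) - emeasure \<Lambda> (H \<inter> (B \<inter> C))"
      using fin sets poisson_count_mult[of "H \<inter> B" "H \<inter> C"] poisson_count_mean[of "H \<inter> (B \<inter> C)"]
      by (simp add: inf_assoc inf_left_commute[of B H])
    also have "\<dots> = emeasure \<Lambda> (H \<inter> B) * emeasure \<Lambda> (H \<inter> C)"
      using fin[of "B \<inter> C"] by (intro ennreal_add_diff_cancel_right) auto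
    also have "\<dots> = emeasure (\<rho> \<Otimes>\<^sub>M \<rho>) A"
      unfolding A by (subst \<rho>.emeasure_pair_measure_Times) (auto simp: \<rho> Int_commute)
    finally show ?thesis .
  qed
  have sets_pair: "sets (\<rho> \<Otimes>\<^sub>M \<rho>) = sets (\<Lambda> \<Otimes>\<^sub>M \<Lambda>)"
    by (intro sets_pair_measure_cong) (auto simp: \<rho>_def)
  have f': "f \<in> borel_measurable (\<rho> \<Otimes>\<^sub>M \<rho>)"
    using f by (simp cong: measurable_cong_sets add: sets_pair)
  have E: "Int_stable E" "E \<subseteq> Pow (space (\<rho> \<Otimes>\<^sub>M \<rho>))"
    "sets (\<rho> \<Otimes>\<^sub>M \<rho>) = sigma_sets (space (\<rho> \<Otimes>\<^sub>M \<rho>)) E"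
    unfolding E_def using Int_stable_pair_measure_generator[of \<rho> \<rho>]
    by (auto simp: sets_pair_measure space_pair_measure space)
  have "space (\<rho> \<Otimes>\<^sub>M \<rho>) \<in> E"
    unfolding E_def space_pair_measure by blast
  note E = E this
  show "(\<lambda>\<omega>. \<Sum>z\<in>distinct_pairs (\<Psi> \<omega> \<inter> H). f z) \<in> borel_measurable M"
    by (rule main) (use E fin_pair meas int f' in \<open>auto simp: finite_distinct_pairs space_pair_measure space\<close>)
  have "(\<integral>\<^sup>+\<omega>. (\<Sum>z\<in>distinct_pairs (\<Psi> \<omega> \<inter> H). f z) \<partial>M) = (\<integral>\<^sup>+z. f z \<partial>(\<rho> \<Otimes>\<^sub>M \<rho>))"
    by (rule main) (use E fin_pair meas int f' in \<open>auto simp: finite_distinct_pairs space_pair_measure space\<close>)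
  also have "\<dots> = (\<integral>\<^sup>+x. (\<integral>\<^sup>+y. f (x, y) \<partial>\<rho>) \<partial>\<rho>)"
    using f' by (rule \<rho>.nn_integral_fst[symmetric])
  also have "\<dots> = (\<integral>\<^sup>+x\<in>H. (\<integral>\<^sup>+y. f (x, y) \<partial>\<rho>) \<partial>\<Lambda>)"
    unfolding \<rho>_def[THEN arg_cong, of "\<lambda>\<rho>'. nn_integral \<rho>' (\<lambda>x. \<integral>\<^sup>+y. f (x, y) \<partial>\<rho>)"]
    using f' by (subst nn_integral_density) (auto simp: mult.commute)
  also have "\<dots> = (\<integral>\<^sup>+x\<in>H. (\<integral>\<^sup>+y\<in>H. f (x, y) \<partial>\<Lambda>) \<partial>\<Lambda>)"
  proof (intro nn_integral_cong arg_cong2[of _ _ _ _ "(*)"] refl)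
    fix x
    have "(\<lambda>y. f (x, y)) \<in> borel_measurable \<Lambda>"
      using f by (intro measurable_compose_Pair1) (auto simp: space)
    then show "(\<integral>\<^sup>+y. f (x, y) \<partial>\<rho>) = (\<integral>\<^sup>+y\<in>H. f (x, y) \<partial>\<Lambda>)"
      unfolding \<rho>_def by (subst nn_integral_density) (auto simp: mult.commute)
  qed
  finally show "(\<integral>\<^sup>+\<omega>. (\<Sum>z\<in>distinct_pairs (\<Psi> \<omega> \<inter> H). f z) \<partial>M)
      = (\<integral>\<^sup>+x\<in>H. (\<integral>\<^sup>+y\<in>H. f (x, y) \<partial>\<Lambda>) \<partial>\<Lambda>)" .
qed

end

section \<open>Numbering points by their entry into growing windows\<close>

text \<open>For \<open>N\<close> beyond \<open>n\<close>, the ratio \<open>(N/n)\<^sup>2\<close> grows at most like \<open>exp (2 (N - n) / n)\<close>, which for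
large \<open>n\<close> is slower than the growth of \<open>(1/\<theta>)\<^bsup>N - n\<^esup>\<close>.\<close>

lemma square_le_exponential:
  assumes \<theta>: "0 < \<theta>" "\<theta> < 1" and n: "0 < n" "2 \<le> real n * ln (1 / \<theta>)" and "n \<le> N"
  shows "(real N)\<^sup>2 \<le> (real n)\<^sup>2 * \<theta> ^ n * (1 / \<theta>) ^ N"
proof -
  define \<delta> where "\<delta> = ln (1 / \<theta>)"
  have \<theta>_eq: "1 / \<theta> = exp \<delta>" "\<theta> = exp (- \<delta>)"
    using \<theta> by (auto simp: \<delta>_def exp_minus)
  have \<delta>: "2 / real n \<le> \<delta>"
    using n by (simp add: \<delta>_def field_simps)
  have "real N / real n = 1 + (real N - real n) / real n"
    using n by (simp add: field_simps)
  also have "\<dots> \<le> exp ((real N - real n) / real n)"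
    by (rule exp_ge_add_one_self)
  finally have "(real N / real n)\<^sup>2 \<le> (exp ((real N - real n) / real n))\<^sup>2"
    by (intro power_mono) auto
  also have "\<dots> = exp ((real N - real n) * (2 / real n))"
    by (simp add: exp_of_nat_mult[symmetric] mult.commute)
  also have "\<dots> \<le> exp ((real N - real n) * \<delta>)"
    unfolding exp_le_cancel_iff using \<delta> \<open>n \<le> N\<close> by (intro mult_left_mono) auto
  also have "\<dots> = \<theta> ^ n * (1 / \<theta>) ^ N"
    unfolding \<theta>_eq(1) unfolding \<theta>_eq(2) by (simp add: exp_of_nat_mult[symmetric] algebra_simps flip: exp_add)
  finally show ?thesis
    using n by (simp add: field_simps power_divide)
qed

text \<open>Only the nesting and the right continuity of the windows matter for the numbering of the points: the
positive times at which an arriving point is visible are all those from some least time on, unless the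
point is visible at every positive time.\<close>

locale observation_windows =
  fixes W :: "real \<Rightarrow> 'a set"
  assumes W_mono: "0 < s \<Longrightarrow> s \<le> t \<Longrightarrow> W s \<subseteq> W t"
    and W_right_closed: "0 < s \<Longrightarrow> (\<And>t. s < t \<Longrightarrow> x \<in> W t) \<Longrightarrow> x \<in> W s"
begin

definition entry :: "'a \<Rightarrow> real" where
  "entry x = (LEAST t. 0 < t \<and> x \<in> W t)"

text \<open>Points in every window. They have no least positive time of visibility, so their entry time is
an unspecified value, and they have to be excluded from all arguments.\<close>

definition initial :: "'a set" where
  "initial = (\<Inter>n. W (1 / real (Suc n)))"

lemma entry_le_iff:
  assumes "0 < u" "x \<in> W u" "x \<notin> initial"
  shows entry_pos: "0 < entry x"
    and "0 < s \<Longrightarrow> entry x \<le> s \<longleftrightarrow> x \<in> W s"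
proof -
  define S where "S = {t. 0 < t \<and> x \<in> W t}"
  (* A window that misses x bounds its times of visibility away from 0. *)
  obtain n where n: "x \<notin> W (1 / real (Suc n))"
    using assms(3) by (auto simp: initial_def)
  have lower: "1 / real (Suc n) \<le> t" if "t \<in> S" for t
  proof (rule ccontr)
    assume "\<not> 1 / real (Suc n) \<le> t"
    then have "W t \<subseteq> W (1 / real (Suc n))"
      using that by (intro W_mono) (auto simp: S_def)
    with n that show False by (auto simp: S_def)
  qed
  have S: "S \<noteq> {}" "bdd_below S"
  proof -
    show "S \<noteq> {}" using assms by (auto simp: S_def)
    show "bdd_below S" using lower by (rule bdd_belowI)
  qed
  then have "1 / real (Suc n) \<le> Inf S"
    using lower by (intro cInf_greatest)
  moreover have "0 < 1 / real (Suc n)" by simp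
  ultimately have Inf_pos: "0 < Inf S" by linarith
  have "x \<in> W t" if "Inf S < t" for t
  proof -
    obtain s where "s \<in> S" "s < t"
      using \<open>Inf S < t\<close> S by (auto simp: cInf_less_iff)
    then show ?thesis
      using W_mono[of s t] by (auto simp: S_def)
  qed
  then have Inf_W: "x \<in> W (Inf S)"
    using Inf_pos by (rule W_right_closed[rotated])
  have least: "Inf S \<le> t" if "0 < t" "x \<in> W t" for t
    using that S by (intro cInf_lower) (auto simp: S_def)
  have entry: "entry x = Inf S"
    unfolding entry_def using Inf_pos Inf_W least by (intro Least_equality) auto
  show "0 < entry x"
    using Inf_pos entry by simp
  show "entry x \<le> s \<longleftrightarrow> x \<in> W s" if "0 < s"
    using that least Inf_W W_mono[of "Inf S" s] Inf_pos by (auto simp: entry)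
qed

definition arrived :: "'a set \<Rightarrow> 'a set" where
  "arrived \<phi> = {x \<in> \<phi>. \<exists>t>0. x \<in> W t}"

definition rank :: "'a set \<Rightarrow> 'a \<Rightarrow> nat" where
  "rank \<phi> x = card {y \<in> arrived \<phi>. entry y \<le> entry x}"

definition regular :: "'a set \<Rightarrow> bool" where
  "regular \<phi> \<longleftrightarrow> (\<forall>t>0. finite (\<phi> \<inter> W t)) \<and> \<phi> \<inter> initial = {} \<and> inj_on entry (arrived \<phi>)"

lemma arrived_until:
  assumes "regular \<phi>" "0 < t"
  shows "{x \<in> arrived \<phi>. entry x \<le> t} = \<phi> \<inter> W t"
  using assms entry_le_iff(2) by (fastforce simp: regular_def arrived_def)

text \<open>Without ties the rank strictly increases with the entry time. The points visible at time \<open>t\<close> are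
closed under earlier entry, so their ranks lie between one and their number, and injectivity makes
these the only values. Hence the first \<open>N(t)\<close> points by rank are the points in the window.\<close>

lemma rank_bij_betw:
  assumes \<phi>: "regular \<phi>" and t: "0 < t"
  shows "bij_betw (rank \<phi>) (\<phi> \<inter> W t) {1..card (\<phi> \<inter> W t)}"
    and "x \<in> arrived \<phi> \<Longrightarrow> (THE y. y \<in> arrived \<phi> \<and> rank \<phi> y = rank \<phi> x) = x"
proof -
  have pos: "0 < entry x" if "x \<in> arrived \<phi>" for x
    using that \<phi> entry_pos by (auto simp: arrived_def regular_def)
  have fin: "finite {y \<in> arrived \<phi>. entry y \<le> s}" if "0 < s" for s
    using that \<phi> by (simp add: arrived_until) (simp add: regular_def)
  have mono: "rank \<phi> x < rank \<phi> y" if "x \<in> arrived \<phi>" "y \<in> arrived \<phi>" "entry x < entry y" for x y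
    unfolding rank_def using that fin[OF pos[of y]] by (intro psubset_card_mono) force+
  have inj: "inj_on (rank \<phi>) (arrived \<phi>)"
  proof (rule inj_onI)
    fix x y assume xy: "x \<in> arrived \<phi>" "y \<in> arrived \<phi>" "rank \<phi> x = rank \<phi> y"
    then have "entry x = entry y"
      using mono[of x y] mono[of y x] by (cases "entry x" "entry y" rule: linorder_cases) auto
    with xy \<phi> show "x = y" by (auto simp: regular_def inj_on_def)
  qed
  then show "x \<in> arrived \<phi> \<Longrightarrow> (THE y. y \<in> arrived \<phi> \<and> rank \<phi> y = rank \<phi> x) = x"
    by (intro the_equality) (auto simp: inj_on_def)
  have A: "\<phi> \<inter> W t = {x \<in> arrived \<phi>. entry x \<le> t}"
    using arrived_until[OF \<phi> t] by simp
  have inj': "inj_on (rank \<phi>) (\<phi> \<inter> W t)"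
    using inj by (rule inj_on_subset) (auto simp: A)
  have "rank \<phi> ` (\<phi> \<inter> W t) \<subseteq> {1..card (\<phi> \<inter> W t)}"
  proof safe
    fix x assume "x \<in> \<phi>" "x \<in> W t"
    then have x: "x \<in> arrived \<phi>" "entry x \<le> t" using A by auto
    have "rank \<phi> x \<le> card (\<phi> \<inter> W t)"
      unfolding rank_def A using fin[OF t] x by (intro card_mono) auto
    moreover have "rank \<phi> x \<noteq> 0"
      unfolding rank_def using fin[OF pos[OF x(1)]] x by auto
    ultimately show "rank \<phi> x \<in> {1..card (\<phi> \<inter> W t)}" by auto
  qed
  then have "rank \<phi> ` (\<phi> \<inter> W t) = {1..card (\<phi> \<inter> W t)}"
    using inj' by (intro card_subset_eq) (auto simp: card_image)
  then show "bij_betw (rank \<phi>) (\<phi> \<inter> W t) {1..card (\<phi> \<inter> W t)}"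
    using inj' by (simp add: bij_betw_def)
qed

definition numbered :: "'a set \<Rightarrow> nat \<Rightarrow> 'a" where
  "numbered \<phi> i = (THE x. x \<in> \<phi> \<and> (\<exists>t>0. x \<in> W t) \<and>
     card {y \<in> \<phi>. (\<exists>t>0. y \<in> W t) \<and> entry y \<le> entry x} = i)"

lemma sum_numbered_pairs:
  assumes \<phi>: "regular \<phi>" and t: "0 < t"
  shows "(\<Sum>(i, j)\<in>distinct_pairs {1..card (\<phi> \<inter> W t)}. F (numbered \<phi> i) (numbered \<phi> j))
    = (\<Sum>(x, y)\<in>distinct_pairs (\<phi> \<inter> W t). F x y)"
proof -
  let ?N = "card (\<phi> \<inter> W t)"
  have numbered: "numbered \<phi> (rank \<phi> x) = x" if "x \<in> \<phi> \<inter> W t" for x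
  proof -
    have "x \<in> arrived \<phi>" using that t by (auto simp: arrived_def)
    then show ?thesis
      using rank_bij_betw(2)[OF \<phi> t, of x]
      by (simp add: numbered_def arrived_def rank_def conj_assoc)
  qed
  note bij = rank_bij_betw(1)[OF \<phi> t]
  have fin: "finite (\<phi> \<inter> W t)"
    using \<phi> t by (auto simp: regular_def)
  have "bij_betw (map_prod (rank \<phi>) (rank \<phi>)) (distinct_pairs (\<phi> \<inter> W t)) (distinct_pairs {1..?N})"
    using bij by (rule bij_betw_distinct_pairs)
  then have "(\<Sum>(i, j)\<in>distinct_pairs {1..?N}. F (numbered \<phi> i) (numbered \<phi> j))
    = (\<Sum>z\<in>distinct_pairs (\<phi> \<inter> W t).
         (\<lambda>(i, j). F (numbered \<phi> i) (numbered \<phi> j)) (map_prod (rank \<phi>) (rank \<phi>) z))"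
    by (rule sum.reindex_bij_betw[symmetric])
  also have "\<dots> = (\<Sum>(x, y)\<in>distinct_pairs (\<phi> \<inter> W t). F x y)"
    using fin by (intro sum.cong) (auto simp: distinct_pairs_def numbered)
  finally show ?thesis .
qed

definition pair_sum :: "('a \<Rightarrow> 'a \<Rightarrow> real) \<Rightarrow> nat \<Rightarrow> 'a set \<Rightarrow> real" where
  "pair_sum F n \<phi> = (\<Sum>(i, j)\<in>distinct_pairs {1..n}. F (numbered \<phi> i) (numbered \<phi> j))"

lemma pair_sum_mono:
  assumes "\<And>x y. 0 \<le> F x y" "m \<le> n"
  shows "pair_sum F m \<phi> \<le> pair_sum F n \<phi>"
  unfolding pair_sum_def using assms
  by (intro sum_mono2 finite_distinct_pairs distinct_pairs_mono) auto

lemma pair_sum_nonneg: "(\<And>x y. 0 \<le> F x y) \<Longrightarrow> 0 \<le> pair_sum F n \<phi>"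
  unfolding pair_sum_def by (intro sum_nonneg) auto

lemma pair_sum_le_square:
  assumes "\<And>x y. F x y \<le> 1"
  shows "pair_sum F n \<phi> \<le> (real n)\<^sup>2"
proof -
  have "pair_sum F n \<phi> \<le> (\<Sum>(i, j)\<in>distinct_pairs {1..n}. 1)"
    unfolding pair_sum_def using assms by (intro sum_mono) auto
  also have "\<dots> \<le> (real n)\<^sup>2"
    using card_distinct_pairs_le[of "{1..n}"] by (simp flip: of_nat_power)
  finally show ?thesis .
qed

lemma pair_sum_card:
  assumes "regular \<phi>" "0 < t"
  shows "pair_sum F (card (\<phi> \<inter> W t)) \<phi> = (\<Sum>(x, y)\<in>distinct_pairs (\<phi> \<inter> W t). F x y)"
  unfolding pair_sum_def by (rule sum_numbered_pairs[OF assms])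

text \<open>If fewer than \<open>n\<close> points have arrived, some of the numbers up to \<open>n\<close> may name no visible point and
only the trivial bound \<open>n\<^sup>2\<close> is left. It is absorbed by the exponential factor, which is then at least
one.\<close>

lemma pair_sum_upper:
  assumes F: "\<And>x y. 0 \<le> F x y" "\<And>x y. F x y \<le> 1" and \<phi>: "regular \<phi>" "0 < t" and \<theta>: "1 < \<theta>"
  shows "pair_sum F n \<phi> \<le> (\<Sum>(x, y)\<in>distinct_pairs (\<phi> \<inter> W t). F x y)
    + (real n)\<^sup>2 * \<theta> ^ n * (1 / \<theta>) ^ card (\<phi> \<inter> W t)"
proof (cases "n \<le> card (\<phi> \<inter> W t)")
  case True
  have "0 \<le> (real n)\<^sup>2 * \<theta> ^ n * (1 / \<theta>) ^ card (\<phi> \<inter> W t)"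
    using \<theta> by simp
  then show ?thesis
    using pair_sum_mono[of F, OF F(1) True, of \<phi>] pair_sum_card[OF \<phi>, of F] by simp
next
  case False
  then have "\<theta> ^ card (\<phi> \<inter> W t) \<le> \<theta> ^ n"
    using \<theta> by (intro power_increasing) auto
  then have "1 \<le> \<theta> ^ n * (1 / \<theta>) ^ card (\<phi> \<inter> W t)"
    using \<theta> by (simp add: field_simps power_one_over)
  then have "(real n)\<^sup>2 \<le> (real n)\<^sup>2 * (\<theta> ^ n * (1 / \<theta>) ^ card (\<phi> \<inter> W t))"
    using mult_left_mono[of 1 _ "(real n)\<^sup>2"] by simp
  moreover have "0 \<le> (\<Sum>(x, y)\<in>distinct_pairs (\<phi> \<inter> W t). F x y)"
    using F by (intro sum_nonneg) auto
  ultimately show ?thesis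
    using pair_sum_le_square[of F n \<phi>] F(2) by (simp add: mult.assoc)
qed

text \<open>If more than \<open>n\<close> points have arrived, the sum over the window is at most the squared
number of points, and \<open>square_le_exponential\<close> turns this into the error term.\<close>

lemma pair_sum_lower:
  assumes F: "\<And>x y. 0 \<le> F x y" "\<And>x y. F x y \<le> 1" and \<phi>: "regular \<phi>" "0 < t"
    and \<theta>: "0 < \<theta>" "\<theta> < 1" and n: "0 < n" "2 \<le> real n * ln (1 / \<theta>)"
  shows "(\<Sum>(x, y)\<in>distinct_pairs (\<phi> \<inter> W t). F x y) \<le>
    pair_sum F n \<phi> + (real n)\<^sup>2 * \<theta> ^ n * (1 / \<theta>) ^ card (\<phi> \<inter> W t)"
proof (cases "card (\<phi> \<inter> W t) \<le> n")
  case True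
  have "0 \<le> (real n)\<^sup>2 * \<theta> ^ n * (1 / \<theta>) ^ card (\<phi> \<inter> W t)"
    using \<theta> by simp
  then show ?thesis
    using pair_sum_mono[of F, OF F(1) True, of \<phi>] pair_sum_card[OF \<phi>, of F] by simp
next
  case False
  then have "(real (card (\<phi> \<inter> W t)))\<^sup>2 \<le> (real n)\<^sup>2 * \<theta> ^ n * (1 / \<theta>) ^ card (\<phi> \<inter> W t)"
    by (intro square_le_exponential \<theta> n) auto
  moreover have "pair_sum F (card (\<phi> \<inter> W t)) \<phi> \<le> (real (card (\<phi> \<inter> W t)))\<^sup>2"
    by (intro pair_sum_le_square F)
  moreover have "0 \<le> pair_sum F n \<phi>"
    by (intro pair_sum_nonneg F)
  ultimately show ?thesis
    using pair_sum_card[OF \<phi>, of F] by simp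
qed

end

text \<open>Time is calibrated so that the window at time \<open>t\<close> contains \<open>t\<close> points on average.\<close>

locale poisson_arrivals = observation_windows W
  for W :: "real \<Rightarrow> 'a::topological_space set" +
  fixes M :: "'w measure" and \<Lambda> :: "'a measure" and \<Psi> :: "'w \<Rightarrow> 'a set"
  assumes poisson: "poisson_process M \<Lambda> \<Psi>"
    and sets_intensity: "sets \<Lambda> = sets borel"
    and W_borel: "W t \<in> sets borel"
    and intensity_W: "0 < t \<Longrightarrow> emeasure \<Lambda> (W t) = ennreal t"
begin

lemma initial_borel: "initial \<in> sets borel"
  unfolding initial_def using W_borel by auto

lemma emeasure_W_diff: "0 < s \<Longrightarrow> s \<le> t \<Longrightarrow> emeasure \<Lambda> (W t - W s) = ennreal (t - s)"
  using W_mono[of s t] W_borel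
  by (subst emeasure_Diff) (auto simp: intensity_W sets_intensity ennreal_minus)

lemma emeasure_initial: "emeasure \<Lambda> initial = 0"
proof -
  have "emeasure \<Lambda> initial \<le> 0 + ennreal e" if "0 < e" for e
  proof -
    obtain n where "1 / real (Suc n) < e"
      using \<open>0 < e\<close> nat_approx_posE by blast
    then have "ennreal (1 / real (Suc n)) \<le> ennreal e"
      by (intro ennreal_leI) simp
    moreover have "emeasure \<Lambda> initial \<le> emeasure \<Lambda> (W (1 / real (Suc n)))"
      using W_borel sets_intensity by (intro emeasure_mono) (auto simp: initial_def)
    ultimately show ?thesis
      using intensity_W[of "1 / real (Suc n)"] by simp
  qed
  then have "emeasure \<Lambda> initial \<le> 0"
    by (rule ennreal_le_epsilon)
  then show ?thesis by simp
qed

text \<open>A total measurable substitute for the entry time: its sublevel sets are built from windows, whereas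
the least time is unspecified for the points that never arrive or are always visible.\<close>

definition entry_upto :: "real \<Rightarrow> 'a \<Rightarrow> real" where
  "entry_upto t x = (if x \<in> W t - initial then entry x else 0)"

lemma entry_upto_measurable:
  assumes "0 < t"
  shows "entry_upto t \<in> borel_measurable borel"
  unfolding borel_measurable_iff_le
proof
  fix a :: real
  have "{x \<in> space borel. entry_upto t x \<le> a} =
    (if a < 0 then {} else if a = 0 then - (W t - initial) else - (W t - initial) \<union> W a)"
  proof (rule set_eqI)
    fix x
    show "x \<in> {x \<in> space borel. entry_upto t x \<le> a} \<longleftrightarrow> x \<in>
      (if a < 0 then {} else if a = 0 then - (W t - initial) else - (W t - initial) \<union> W a)"
    proof (cases "x \<in> W t - initial")
      case True
      then show ?thesis
        using entry_pos[OF assms, of x] entry_le_iff(2)[OF assms, of x a]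
        by (auto simp: entry_upto_def)
    qed (auto simp: entry_upto_def)
  qed
  also have "\<dots> \<in> sets borel"
    using W_borel[of t] W_borel[of a] initial_borel by simp
  finally show "{x \<in> space borel. entry_upto t x \<le> a} \<in> sets borel" .
qed

text \<open>The points that enter exactly at time \<open>s\<close> lie in a difference of two windows whose measure is the
difference of their times.\<close>

lemma entry_upto_diffuse:
  assumes t: "0 < t" and "s \<noteq> 0"
  shows "emeasure \<Lambda> {x. entry_upto t x = s} = 0"
proof (cases "0 < s")
  case True
  have "emeasure \<Lambda> {x. entry_upto t x = s} \<le> 0 + ennreal e" if "0 < e" for e
  proof -
    (* The window at r has to be earlier than s by at most e and at a positive time. *)
    define r where "r = max (s - e) (s / 2)"
    have r: "0 < r" "r < s" "s - r \<le> e"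
      using True \<open>0 < e\<close> by (auto simp: r_def)
    have "{x. entry_upto t x = s} \<subseteq> W s - W r"
    proof
      fix x assume "x \<in> {x. entry_upto t x = s}"
      then have "x \<in> W t" "x \<notin> initial" "entry x = s"
        using \<open>s \<noteq> 0\<close> by (auto simp: entry_upto_def split: if_splits)
      then show "x \<in> W s - W r"
        using entry_le_iff(2)[OF t, of x s] entry_le_iff(2)[OF t, of x r] r True by auto
    qed
    then have "emeasure \<Lambda> {x. entry_upto t x = s} \<le> emeasure \<Lambda> (W s - W r)"
      using W_borel by (intro emeasure_mono) (auto simp: sets_intensity)
    also have "\<dots> \<le> ennreal e"
      using r by (subst emeasure_W_diff) (auto intro!: ennreal_leI)
    finally show ?thesis by simp
  qed
  then have "emeasure \<Lambda> {x. entry_upto t x = s} \<le> 0"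
    by (rule ennreal_le_epsilon)
  then show ?thesis by simp
next
  case False
  then have "{x. entry_upto t x = s} = {}"
    using \<open>s \<noteq> 0\<close> entry_pos[OF t] by (auto simp: entry_upto_def split: if_splits)
  then show ?thesis by simp
qed

interpretation prob_space M
  using poisson by (simp add: poisson_process_def)

text \<open>Local finiteness and avoidance of the null set \<open>initial\<close> hold because of the mean counts. Ties are
excluded by the pair formula: a pair of points with equal entry times belongs to a set that is null
for \<open>\<Lambda> \<otimes> \<Lambda>\<close>, since each of its slices is null.\<close>

lemma AE_regular: "AE \<omega> in M. regular (\<Psi> \<omega>)"
proof -
  have "AE \<omega> in M. finite (\<Psi> \<omega> \<inter> W (real (Suc m)))" for m
    by (intro poisson_count_AE_finite[OF poisson] W_borel) (simp add: intensity_W)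
  then have fin: "AE \<omega> in M. \<forall>m. finite (\<Psi> \<omega> \<inter> W (real (Suc m)))"
    by (simp add: AE_all_countable)
  have "(\<integral>\<^sup>+\<omega>. point_count (\<Psi> \<omega>) initial \<partial>M) = 0"
    using poisson_count_mean[OF poisson initial_borel] by (simp add: emeasure_initial)
  then have "AE \<omega> in M. point_count (\<Psi> \<omega>) initial = 0"
    by (subst (asm) nn_integral_0_iff_AE) (auto intro: poisson_count_measurable[OF poisson] initial_borel)
  then have init: "AE \<omega> in M. \<Psi> \<omega> \<inter> initial = {}"
    by eventually_elim (auto simp: point_count_def emeasure_count_space split: if_splits)
  have tie: "AE \<omega> in M. \<forall>(x, y)\<in>distinct_pairs (\<Psi> \<omega> \<inter> W t).
      entry_upto t x = entry_upto t y \<longrightarrow> entry_upto t x = 0" if t: "0 < t" for t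
  proof -
    define f :: "'a \<times> 'a \<Rightarrow> ennreal" where
      "f = indicator {z. entry_upto t (fst z) = entry_upto t (snd z) \<and> entry_upto t (fst z) \<noteq> 0}"
    have sp: "space \<Lambda> = UNIV"
      using sets_eq_imp_space_eq[OF sets_intensity] by simp
    have e [measurable]: "entry_upto t \<in> borel_measurable \<Lambda>"
      using entry_upto_measurable[OF t] by (simp cong: measurable_cong_sets add: sets_intensity)
    have "{z \<in> space (\<Lambda> \<Otimes>\<^sub>M \<Lambda>). entry_upto t (fst z) = entry_upto t (snd z) \<and> entry_upto t (fst z) \<noteq> 0}
      \<in> sets (\<Lambda> \<Otimes>\<^sub>M \<Lambda>)"
      by measurable
    then have f: "f \<in> borel_measurable (\<Lambda> \<Otimes>\<^sub>M \<Lambda>)"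
      unfolding f_def by (intro borel_measurable_indicator) (simp add: space_pair_measure sp)
    have slice: "(\<integral>\<^sup>+y\<in>W t. f (x, y) \<partial>\<Lambda>) = 0" for x
    proof -
      have A: "{y. entry_upto t y = entry_upto t x} \<in> sets \<Lambda>"
        using measurable_sets[OF e, of "{entry_upto t x}"] by (simp add: vimage_def sp)
      have "(\<integral>\<^sup>+y\<in>W t. f (x, y) \<partial>\<Lambda>) \<le>
          (\<integral>\<^sup>+y. (if entry_upto t x = 0 then 0 else 1) * indicator {y. entry_upto t y = entry_upto t x} y \<partial>\<Lambda>)"
        by (intro nn_integral_mono) (auto simp: f_def indicator_def)
      also have "\<dots> = (if entry_upto t x = 0 then 0 else 1) * emeasure \<Lambda> {y. entry_upto t y = entry_upto t x}"
        using A by (subst nn_integral_cmult_indicator) auto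
      also have "\<dots> = 0"
        using entry_upto_diffuse[OF t, of "entry_upto t x"] by auto
      finally show ?thesis by simp
    qed
    have fin_W: "emeasure \<Lambda> (W t) < \<infinity>"
      using t by (simp add: intensity_W)
    have "(\<integral>\<^sup>+\<omega>. (\<Sum>z\<in>distinct_pairs (\<Psi> \<omega> \<inter> W t). f z) \<partial>M) = 0"
      unfolding poisson_pairs_nn_integral(2)[OF poisson W_borel fin_W sets_intensity f] by (simp add: slice)
    then have "AE \<omega> in M. (\<Sum>z\<in>distinct_pairs (\<Psi> \<omega> \<inter> W t). f z) = 0"
      using poisson_pairs_measurable[OF poisson W_borel fin_W sets_intensity f]
      by (subst (asm) nn_integral_0_iff_AE) auto
    then show ?thesis
      by eventually_elim (auto simp: finite_distinct_pairs f_def indicator_def split: if_splits)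
  qed
  have "AE \<omega> in M. \<forall>m. \<forall>(x, y)\<in>distinct_pairs (\<Psi> \<omega> \<inter> W (real (Suc m))).
      entry_upto (real (Suc m)) x = entry_upto (real (Suc m)) y \<longrightarrow> entry_upto (real (Suc m)) x = 0"
    unfolding AE_all_countable by (intro allI tie) simp
  with fin init show ?thesis
  proof eventually_elim
    case (elim \<omega>)
    have large: "\<exists>m. t \<le> real (Suc m)" for t
      using real_arch_simple[of t] by (metis le_Suc_eq linorder_not_le nle_le of_nat_le_iff order_trans)
    have "finite (\<Psi> \<omega> \<inter> W t)" if "0 < t" for t
    proof -
      obtain m where "t \<le> real (Suc m)" using large by blast
      then show ?thesis
        using W_mono[OF \<open>0 < t\<close>] elim(1) by (meson Int_mono finite_subset order_refl)
    qed
    moreover have "inj_on entry (arrived (\<Psi> \<omega>))"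
    proof (rule inj_onI, rule ccontr)
      fix x y assume xy: "x \<in> arrived (\<Psi> \<omega>)" "y \<in> arrived (\<Psi> \<omega>)" "entry x = entry y" "x \<noteq> y"
      then obtain s t where st: "0 < s" "x \<in> W s" "0 < t" "y \<in> W t" and \<Psi>: "x \<in> \<Psi> \<omega>" "y \<in> \<Psi> \<omega>"
        by (auto simp: arrived_def)
      obtain m where m: "max s t \<le> real (Suc m)" using large by blast
      then have W: "x \<in> W (real (Suc m))" "y \<in> W (real (Suc m))"
        using st W_mono[of s "real (Suc m)"] W_mono[of t "real (Suc m)"] by auto
      then have "(x, y) \<in> distinct_pairs (\<Psi> \<omega> \<inter> W (real (Suc m)))"
        using \<Psi> xy elim(1) by (simp add: distinct_pairs_def del: of_nat_Suc)
      moreover have "x \<notin> initial" "y \<notin> initial"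
        using \<Psi> elim(2) by auto
      ultimately show False
        using elim(3) W xy(3) entry_pos[OF st(1,2)] by (fastforce simp: entry_upto_def simp del: of_nat_Suc)
    qed
    ultimately show ?case
      using elim(2) by (simp add: regular_def)
  qed
qed

lemma count_generating_function:
  assumes "0 < t" "0 \<le> s"
  shows "(\<integral>\<^sup>+\<omega>. ennreal (s ^ card (\<Psi> \<omega> \<inter> W t)) \<partial>M) = ennreal (exp (t * (s - 1)))"
proof -
  have "measure \<Lambda> (W t) = t"
    using intensity_W[OF assms(1)] assms(1) by (simp add: measure_def)
  then show ?thesis
    using assms poisson_count_nn_integral[OF poisson W_borel, of t "\<lambda>k. ennreal (s ^ k)"]
      poisson_generating_function[of t s]
    by (simp add: intensity_W)
qed

text \<open>The comparison of a fixed number \<open>n\<close> of points with the fixed time \<open>\<theta> n\<close>, in expectation. The sum over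
the first \<open>n\<close> points enters through a measurable function \<open>V\<close> that agrees with it almost everywhere,
which avoids any claim about the measurability of the numbering.\<close>

lemma expected_pair_sum_bounds:
  fixes F :: "'a \<Rightarrow> 'a \<Rightarrow> real" and V :: "'w \<Rightarrow> real"
  assumes F: "\<And>x y. 0 \<le> F x y" "\<And>x y. F x y \<le> 1"
    and F_meas: "(\<lambda>(x, y). F x y) \<in> borel_measurable (\<Lambda> \<Otimes>\<^sub>M \<Lambda>)"
    and V: "V \<in> borel_measurable M" "AE \<omega> in M. V \<omega> = pair_sum F n (\<Psi> \<omega>)"
    and \<theta>: "0 < \<theta>" and n: "0 < n"
  defines "t \<equiv> \<theta> * real n"
  defines "I \<equiv> (\<integral>\<^sup>+x\<in>W t. (\<integral>\<^sup>+y\<in>W t. ennreal (F x y) \<partial>\<Lambda>) \<partial>\<Lambda>)"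
  defines "\<epsilon> \<equiv> ennreal ((real n)\<^sup>2 * (\<theta> * exp (1 - \<theta>)) ^ n)"
  shows "1 < \<theta> \<Longrightarrow> (\<integral>\<^sup>+\<omega>. ennreal (V \<omega>) \<partial>M) \<le> I + \<epsilon>"
    and "\<theta> < 1 \<Longrightarrow> 2 \<le> real n * ln (1 / \<theta>) \<Longrightarrow> I \<le> (\<integral>\<^sup>+\<omega>. ennreal (V \<omega>) \<partial>M) + \<epsilon>"
proof -
  have t: "0 < t" using \<theta> n by (simp add: t_def)
  have fin_W: "emeasure \<Lambda> (W t) < \<infinity>"
    using t by (simp add: intensity_W)
  define S where "S \<omega> = (\<Sum>z\<in>distinct_pairs (\<Psi> \<omega> \<inter> W t). ennreal (case z of (x, y) \<Rightarrow> F x y))" for \<omega>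
  have F': "(\<lambda>z. ennreal (case z of (x, y) \<Rightarrow> F x y)) \<in> borel_measurable (\<Lambda> \<Otimes>\<^sub>M \<Lambda>)"
    using F_meas by simp
  have S_meas: "S \<in> borel_measurable M"
    unfolding S_def[abs_def] by (rule poisson_pairs_measurable[OF poisson W_borel fin_W sets_intensity F'])
  have S_int: "(\<integral>\<^sup>+\<omega>. S \<omega> \<partial>M) = I"
    unfolding S_def I_def
    by (subst poisson_pairs_nn_integral(2)[OF poisson W_borel fin_W sets_intensity F']) simp
  have S_eq: "S \<omega> = ennreal (\<Sum>(x, y)\<in>distinct_pairs (\<Psi> \<omega> \<inter> W t). F x y)" for \<omega>
    unfolding S_def using F by (subst sum_ennreal) (auto simp: case_prod_beta)
  let ?E = "\<lambda>\<omega>. ennreal ((real n)\<^sup>2 * \<theta> ^ n) * ennreal ((1 / \<theta>) ^ card (\<Psi> \<omega> \<inter> W t))"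
  have "(\<integral>\<^sup>+\<omega>. ennreal ((1 / \<theta>) ^ card (\<Psi> \<omega> \<inter> W t)) \<partial>M) = ennreal (exp (real n * (1 - \<theta>)))"
    using \<theta> by (subst count_generating_function[OF t]) (auto simp: t_def field_simps)
  moreover have meas: "(\<lambda>\<omega>. ennreal ((1 / \<theta>) ^ card (\<Psi> \<omega> \<inter> W t))) \<in> borel_measurable M"
    using poisson_card_measurable[OF poisson W_borel[of t]] by measurable
  ultimately have "(\<integral>\<^sup>+\<omega>. ?E \<omega> \<partial>M) = ennreal ((real n)\<^sup>2 * \<theta> ^ n) * ennreal (exp (real n * (1 - \<theta>)))"
    by (subst nn_integral_cmult) auto
  also have "\<dots> = \<epsilon>"
    using \<theta> by (simp add: \<epsilon>_def power_mult_distrib exp_of_nat_mult[symmetric] mult.assoc flip: ennreal_mult)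
  finally have E: "(\<integral>\<^sup>+\<omega>. ?E \<omega> \<partial>M) = \<epsilon>" "?E \<in> borel_measurable M"
    using meas by auto
  note AE = V(2) AE_regular
  show "(\<integral>\<^sup>+\<omega>. ennreal (V \<omega>) \<partial>M) \<le> I + \<epsilon>" if \<theta>1: "1 < \<theta>"
  proof -
    have "(\<integral>\<^sup>+\<omega>. ennreal (V \<omega>) \<partial>M) \<le> (\<integral>\<^sup>+\<omega>. S \<omega> + ?E \<omega> \<partial>M)"
    proof (intro nn_integral_mono_AE)
      show "AE \<omega> in M. ennreal (V \<omega>) \<le> S \<omega> + ?E \<omega>"
        using AE
      proof eventually_elim
        case (elim \<omega>)
        then show ?case
          using pair_sum_upper[of F "\<Psi> \<omega>" t \<theta> n, OF F elim(2) t \<theta>1] \<theta> F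
          unfolding S_eq by (simp add: sum_nonneg case_prod_beta flip: ennreal_mult ennreal_plus)
      qed
    qed
    then show ?thesis
      using S_meas E S_int by (simp add: nn_integral_add)
  qed
  show "I \<le> (\<integral>\<^sup>+\<omega>. ennreal (V \<omega>) \<partial>M) + \<epsilon>" if \<theta>1: "\<theta> < 1" "2 \<le> real n * ln (1 / \<theta>)"
  proof -
    have "(\<integral>\<^sup>+\<omega>. S \<omega> \<partial>M) \<le> (\<integral>\<^sup>+\<omega>. ennreal (V \<omega>) + ?E \<omega> \<partial>M)"
    proof (intro nn_integral_mono_AE)
      show "AE \<omega> in M. S \<omega> \<le> ennreal (V \<omega>) + ?E \<omega>"
        using AE
      proof eventually_elim
        case (elim \<omega>)
        then show ?case
          using pair_sum_lower[of F "\<Psi> \<omega>" t \<theta> n, OF F elim(2) t \<theta> \<theta>1(1) n \<theta>1(2)] \<theta> F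
            pair_sum_nonneg[of F n "\<Psi> \<omega>"]
          unfolding S_eq by (simp flip: ennreal_mult ennreal_plus)
      qed
    qed
    then show ?thesis
      using V(1) E S_int by (simp add: nn_integral_add)
  qed
qed

end

section \<open>Interaction of two points in a large box\<close>

text \<open>Polar coordinates for radial functions. The volume of a ball determines the distribution function of
the norm, and differentiating it in the radius gives the density.\<close>

lemma distr_norm_lborel:
  "distr (lborel :: 'a::euclidean_space measure) borel norm =
    density lborel (\<lambda>u. ennreal (DIM('a) * unit_ball_vol DIM('a) * u ^ (DIM('a) - 1)) * indicator {0..} u)"
  (is "?L = ?R")
proof (rule measure_eqI_generator_eq)
  let ?n = "DIM('a)" and ?c = "unit_ball_vol (real DIM('a))"
  define E where "E = range (\<lambda>a::real. {..a})"
  show "Int_stable E"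
    by (auto simp: E_def Int_stable_def)
  show "E \<subseteq> Pow UNIV" by simp
  show "sets ?L = sigma_sets UNIV E" "sets ?R = sigma_sets UNIV E"
    by (simp_all add: E_def borel_eq_atMost)
  have L: "emeasure ?L {..r} = (if r < 0 then 0 else ennreal (?c * r ^ ?n))" for r
  proof -
    have "emeasure ?L {..r} = emeasure lborel (cball (0::'a) r)"
      by (subst emeasure_distr) (auto simp: vimage_def cball_def dist_norm)
    then show ?thesis by (simp add: emeasure_cball)
  qed
  show "emeasure ?L X = emeasure ?R X" if "X \<in> E" for X
  proof -
    obtain r where X: "X = {..r}" using \<open>X \<in> E\<close> by (auto simp: E_def)
    have "emeasure ?R {..r} = (\<integral>\<^sup>+u. ennreal (?n * ?c * u ^ (?n - 1)) * indicator {0..r} u \<partial>lborel)"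
      by (subst emeasure_density) (auto intro!: nn_integral_cong simp: indicator_def)
    also have "\<dots> = (if r < 0 then 0 else ennreal (?c * r ^ ?n))"
    proof (cases "r < 0")
      case False
      have "(\<integral>\<^sup>+u. ennreal (?n * ?c * u ^ (?n - 1)) * indicator {0..r} u \<partial>lborel)
        = ennreal (?c * r ^ ?n - ?c * 0 ^ ?n)"
        using False by (intro nn_integral_FTC_Icc) (auto intro!: derivative_eq_intros)
      then show ?thesis using False by (simp add: power_0_left)
    qed simp
    finally show ?thesis by (simp add: X L)
  qed
  show "range (\<lambda>i. {..real i}) \<subseteq> E" by (auto simp: E_def)
  show "(\<Union>i. {..real i}) = UNIV" by (auto simp: real_arch_simple)
  show "emeasure ?L {..real i} \<noteq> \<infinity>" for i by (simp add: L)
qed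

lemma nn_integral_radial:
  fixes f :: "real \<Rightarrow> ennreal"
  assumes [measurable]: "f \<in> borel_measurable borel"
  shows "(\<integral>\<^sup>+x. f (norm x) \<partial>(lborel :: 'a::euclidean_space measure)) =
    ennreal (DIM('a) * unit_ball_vol DIM('a)) * (\<integral>\<^sup>+u\<in>{0..}. ennreal (u ^ (DIM('a) - 1)) * f u \<partial>lborel)"
proof -
  have "(\<integral>\<^sup>+x. f (norm x) \<partial>(lborel :: 'a measure)) = (\<integral>\<^sup>+u. f u \<partial>distr (lborel :: 'a measure) borel norm)"
    by (rule nn_integral_distr[symmetric]) auto
  also have "\<dots> = (\<integral>\<^sup>+u. ennreal (DIM('a) * unit_ball_vol DIM('a) * u ^ (DIM('a) - 1)) * indicator {0..} u * f u \<partial>lborel)"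
    unfolding distr_norm_lborel by (subst nn_integral_density) auto
  also have "\<dots> = (\<integral>\<^sup>+u. ennreal (DIM('a) * unit_ball_vol DIM('a)) * (ennreal (u ^ (DIM('a) - 1)) * f u * indicator {0..} u) \<partial>lborel)"
    by (intro nn_integral_cong) (auto simp: indicator_def ennreal_mult mult_ac)
  also have "\<dots> = ennreal (DIM('a) * unit_ball_vol DIM('a)) * (\<integral>\<^sup>+u\<in>{0..}. ennreal (u ^ (DIM('a) - 1)) * f u \<partial>lborel)"
    by (rule nn_integral_cmult) auto
  finally show ?thesis .
qed

definition centred_box :: "real \<Rightarrow> (real ^ 'd) set" where
  "centred_box g = cbox (\<chi> i. - g) (\<chi> i. g)"

lemma mem_centred_box: "z \<in> centred_box g \<longleftrightarrow> (\<forall>i. \<bar>z $ i\<bar> \<le> g)"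
  by (auto simp: centred_box_def mem_box_cart abs_le_iff minus_le_iff)

lemma centred_box_borel [measurable]: "centred_box g \<in> sets borel"
  by (simp add: centred_box_def)

lemma emeasure_centred_box:
  assumes "0 \<le> g"
  shows "emeasure lborel (centred_box g :: (real ^ 'd) set) = ennreal ((2 * g) ^ CARD('d))"
proof -
  have "((\<chi> i. g) - (\<chi> i. - g) :: real ^ 'd) \<bullet> b = 2 * g" "((\<chi> i. - g) :: real ^ 'd) \<bullet> b \<le> (\<chi> i. g) \<bullet> b"
    if "b \<in> Basis" for b
    using that assms by (auto simp: Basis_vec_def inner_axis)
  then show ?thesis
    unfolding centred_box_def by (subst emeasure_lborel_cbox) simp_all
qed

lemma nn_integral_lborel_translate:
  fixes f :: "'a::euclidean_space \<Rightarrow> ennreal"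
  assumes "f \<in> borel_measurable borel"
  shows "(\<integral>\<^sup>+x. f x \<partial>lborel) = (\<integral>\<^sup>+x. f (c + x) \<partial>lborel)"
  using assms by (subst lborel_distr_plus[of c, symmetric], subst nn_integral_distr) auto

text \<open>The kernel is \<open>w \<mapsto> K(\<parallel>w\<parallel>)\<close>. The type argument carries the space over which it is integrated, which
the value does not show.\<close>

definition mass_within :: "(real \<Rightarrow> real) \<Rightarrow> 'a::euclidean_space itself \<Rightarrow> real \<Rightarrow> ennreal" where
  "mass_within K _ r = (\<integral>\<^sup>+w. ennreal (K (norm w)) * indicator (cball 0 r) (w :: 'a) \<partial>lborel)"

definition total_mass :: "(real \<Rightarrow> real) \<Rightarrow> 'a::euclidean_space itself \<Rightarrow> ennreal" where
  "total_mass K _ = (\<integral>\<^sup>+w. ennreal (K (norm (w :: 'a))) \<partial>lborel)"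

definition box_energy :: "(real \<Rightarrow> real) \<Rightarrow> (real ^ 'd) itself \<Rightarrow> real \<Rightarrow> ennreal" where
  "box_energy K _ g = (\<integral>\<^sup>+z\<in>centred_box g. (\<integral>\<^sup>+z'\<in>centred_box g. ennreal (K (norm (z - z' :: real ^ 'd))) \<partial>lborel) \<partial>lborel)"

text \<open>The average over the points of the box of the kernel mass that the box contains around them.\<close>

definition mean_box_mass :: "(real \<Rightarrow> real) \<Rightarrow> (real ^ 'd) itself \<Rightarrow> real \<Rightarrow> real" where
  "mean_box_mass K T g = enn2real (box_energy K T g) / (2 * g) ^ CARD('d)"

context
  fixes K :: "real \<Rightarrow> real"
  assumes K_antimono: "antimono_on {0..} K"
begin

text \<open>The link function is arbitrary on negative numbers. Freezing it there at its value at \<open>0\<close> makes it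
antimonotone on the whole line and hence Borel, and norms do not see the change.\<close>

lemma K_extended_measurable: "(\<lambda>u. K (max 0 u)) \<in> borel_measurable borel"
proof -
  have "mono (\<lambda>u. - K (max 0 u))"
    using K_antimono by (auto simp: monotone_on_def intro!: monoI)
  then have "(\<lambda>u. - K (max 0 u)) \<in> borel_measurable borel"
    by (rule borel_measurable_mono)
  then show ?thesis by simp
qed

lemma K_norm_measurable [measurable]:
  "(\<lambda>z :: 'a::real_normed_vector. K (norm z)) \<in> borel_measurable borel"
  using measurable_compose[OF _ K_extended_measurable, of norm "borel :: 'a measure"]
  by (simp add: max_def)

lemma total_mass_finite:
  assumes K_nonneg: "\<And>u. 0 \<le> u \<Longrightarrow> 0 \<le> K u"
    and "(\<integral>\<^sup>+u\<in>{0..}. ennreal (u ^ (DIM('a) - 1) * K u) \<partial>lborel) < \<infinity>"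
  shows "total_mass K TYPE('a::euclidean_space) < \<infinity>"
proof -
  have "total_mass K TYPE('a) = (\<integral>\<^sup>+x. ennreal (K (max 0 (norm (x :: 'a)))) \<partial>lborel)"
    by (simp add: total_mass_def max_def)
  also have "\<dots> = ennreal (DIM('a) * unit_ball_vol DIM('a)) *
      (\<integral>\<^sup>+u\<in>{0..}. ennreal (u ^ (DIM('a) - 1)) * ennreal (K (max 0 u)) \<partial>lborel)"
    using K_extended_measurable by (intro nn_integral_radial) simp
  also have "(\<integral>\<^sup>+u\<in>{0..}. ennreal (u ^ (DIM('a) - 1)) * ennreal (K (max 0 u)) \<partial>lborel)
      = (\<integral>\<^sup>+u\<in>{0..}. ennreal (u ^ (DIM('a) - 1) * K u) \<partial>lborel)"
    using K_nonneg by (intro nn_integral_cong) (auto simp: indicator_def max_def ennreal_mult)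
  finally show ?thesis
    using assms by (simp add: ennreal_mult_less_top)
qed

lemma mass_within_le: "mass_within K TYPE('a::euclidean_space) r \<le> total_mass K TYPE('a)"
  unfolding mass_within_def total_mass_def by (intro nn_integral_mono) (auto simp: indicator_def)

lemma mass_within_SUP: "(SUP n. mass_within K TYPE('a::euclidean_space) (real n)) = total_mass K TYPE('a)"
proof -
  have "(SUP n. mass_within K TYPE('a) (real n)) =
      (\<integral>\<^sup>+w. (SUP n. ennreal (K (norm w)) * indicator (cball 0 (real n)) (w :: 'a)) \<partial>lborel)"
    unfolding mass_within_def
    by (intro nn_integral_monotone_convergence_SUP[symmetric])
       (auto simp: incseq_def le_fun_def indicator_def)
  also have "\<dots> = total_mass K TYPE('a)"
    unfolding total_mass_def
  proof (intro nn_integral_cong antisym)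
    fix w :: 'a
    show "(SUP n. ennreal (K (norm w)) * indicator (cball 0 (real n)) w) \<le> ennreal (K (norm w))"
      by (intro SUP_least) (auto simp: indicator_def)
    obtain n where "norm w \<le> real n" using real_arch_simple by blast
    then show "ennreal (K (norm w)) \<le> (SUP n. ennreal (K (norm w)) * indicator (cball 0 (real n)) w)"
      by (intro SUP_upper2[of n]) auto
  qed
  finally show ?thesis .
qed

lemma mass_within_pos:
  assumes "0 < u" "0 < K u" "0 < r"
  shows "0 < mass_within K TYPE('a::euclidean_space) r"
proof -
  (* On the ball of radius s the kernel is at least K u, and the ball is inside the one of radius r. *)
  define s where "s = min u r"
  have s: "0 < s" "s \<le> u" "s \<le> r" using assms by (auto simp: s_def)
  have "0 < ennreal (K u) * emeasure lborel (cball (0::'a) s)"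
    using s assms by (simp add: emeasure_cball ennreal_zero_less_mult_iff)
  also have "\<dots> = (\<integral>\<^sup>+w. ennreal (K u) * indicator (cball 0 s) (w :: 'a) \<partial>lborel)"
    by (simp add: nn_integral_cmult_indicator)
  also have "\<dots> \<le> mass_within K TYPE('a) r"
    unfolding mass_within_def
  proof (intro nn_integral_mono)
    fix w :: 'a
    show "ennreal (K u) * indicator (cball 0 s) w \<le> ennreal (K (norm w)) * indicator (cball 0 r) w"
      using s monotone_onD[OF K_antimono, of "norm w" u] by (auto simp: indicator_def intro!: ennreal_leI)
  qed
  finally show ?thesis .
qed

lemma box_energy_le:
  assumes "0 \<le> g"
  shows "box_energy K TYPE(real ^ 'd) g \<le> ennreal ((2 * g) ^ CARD('d)) * total_mass K TYPE(real ^ 'd)"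
proof -
  have "(\<integral>\<^sup>+z'\<in>centred_box g. ennreal (K (norm (z - z' :: real ^ 'd))) \<partial>lborel) \<le> total_mass K TYPE(real ^ 'd)" for z
  proof -
    have "(\<integral>\<^sup>+z'\<in>centred_box g. ennreal (K (norm (z - z' :: real ^ 'd))) \<partial>lborel)
        \<le> (\<integral>\<^sup>+z'. ennreal (K (norm (z - z' :: real ^ 'd))) \<partial>lborel)"
      by (intro nn_integral_mono) (auto simp: indicator_def)
    also have "\<dots> = total_mass K TYPE(real ^ 'd)"
      by (subst nn_integral_lborel_translate[of _ z]) (auto simp: total_mass_def)
    finally show ?thesis .
  qed
  then have "box_energy K TYPE(real ^ 'd) g \<le> (\<integral>\<^sup>+z\<in>(centred_box g :: (real ^ 'd) set). total_mass K TYPE(real ^ 'd) \<partial>lborel)"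
    unfolding box_energy_def by (intro nn_integral_mono mult_right_mono) auto
  also have "\<dots> = ennreal ((2 * g) ^ CARD('d)) * total_mass K TYPE(real ^ 'd)"
    using assms by (subst nn_integral_cmult_indicator) (auto simp: emeasure_centred_box mult.commute)
  finally show ?thesis .
qed

text \<open>A point at distance at least \<open>r\<close> from the boundary of the box sees the whole kernel mass within
radius \<open>r\<close>.\<close>

lemma box_energy_ge:
  assumes "0 \<le> r" "r \<le> g"
  shows "ennreal ((2 * (g - r)) ^ CARD('d)) * mass_within K TYPE(real ^ 'd) r \<le> box_energy K TYPE(real ^ 'd) g"
proof -
  have inner: "mass_within K TYPE(real ^ 'd) r \<le>
      (\<integral>\<^sup>+z'\<in>centred_box g. ennreal (K (norm (z - z' :: real ^ 'd))) \<partial>lborel)"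
    if z: "z \<in> centred_box (g - r)" for z
  proof -
    have sub: "z + w \<in> centred_box g" if "w \<in> cball 0 r" for w
    proof -
      have "\<bar>z $ i + w $ i\<bar> \<le> g" for i
        using z \<open>w \<in> cball 0 r\<close> component_le_norm_cart[of w i]
        by (auto simp: mem_centred_box dest!: spec[of _ i])
      then show ?thesis by (simp add: mem_centred_box)
    qed
    have "mass_within K TYPE(real ^ 'd) r \<le>
        (\<integral>\<^sup>+w. ennreal (K (norm (z - (z + w)))) * indicator (centred_box g) (z + w) \<partial>lborel)"
      unfolding mass_within_def using sub by (intro nn_integral_mono) (auto simp: indicator_def)
    also have "\<dots> = (\<integral>\<^sup>+z'\<in>centred_box g. ennreal (K (norm (z - z'))) \<partial>lborel)"
      by (rule nn_integral_lborel_translate[symmetric]) measurable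
    finally show ?thesis .
  qed
  have "ennreal ((2 * (g - r)) ^ CARD('d)) * mass_within K TYPE(real ^ 'd) r
      = (\<integral>\<^sup>+z\<in>(centred_box (g - r) :: (real ^ 'd) set). mass_within K TYPE(real ^ 'd) r \<partial>lborel)"
    using assms by (subst nn_integral_cmult_indicator) (auto simp: emeasure_centred_box mult.commute)
  also have "\<dots> \<le> box_energy K TYPE(real ^ 'd) g"
    unfolding box_energy_def
  proof (intro nn_integral_mono)
    fix z :: "real ^ 'd"
    have "z \<in> centred_box g" if "z \<in> centred_box (g - r)"
      using that assms by (auto simp: mem_centred_box intro: order_trans[of _ "g - r"])
    then show "mass_within K TYPE(real ^ 'd) r * indicator (centred_box (g - r)) z \<le>
      (\<integral>\<^sup>+z'\<in>centred_box g. ennreal (K (norm (z - z'))) \<partial>lborel) * indicator (centred_box g) z"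
      using inner[of z] by (auto simp: indicator_def)
  qed
  finally show ?thesis .
qed

context
  assumes fin: "total_mass K TYPE(real ^ 'd) < \<infinity>"
begin

lemma box_energy_finite: "0 \<le> g \<Longrightarrow> box_energy K TYPE(real ^ 'd) g < \<infinity>"
  using box_energy_le[of g, where 'd = 'd] fin
  by (auto intro: le_less_trans simp: ennreal_mult_less_top)

lemma mean_box_mass_le: "0 < g \<Longrightarrow> mean_box_mass K TYPE(real ^ 'd) g \<le> enn2real (total_mass K TYPE(real ^ 'd))"
  using enn2real_mono[OF box_energy_le[of g, where 'd = 'd]] fin
  by (simp add: mean_box_mass_def enn2real_mult ennreal_mult_less_top field_simps)

lemma mean_box_mass_ge:
  assumes "0 \<le> r" "r \<le> g" "0 < g"
  shows "((g - r) / g) ^ CARD('d) * enn2real (mass_within K TYPE(real ^ 'd) r) \<le> mean_box_mass K TYPE(real ^ 'd) g"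
proof -
  have "(2 * (g - r)) ^ CARD('d) * enn2real (mass_within K TYPE(real ^ 'd) r)
      \<le> enn2real (box_energy K TYPE(real ^ 'd) g)"
    using enn2real_mono[OF box_energy_ge[OF assms(1,2), where 'd = 'd]] box_energy_finite[of g] assms
    by (simp add: enn2real_mult)
  moreover have "2 * (g - r) = (g - r) / g * (2 * g)"
    using assms by simp
  then have "(2 * (g - r)) ^ CARD('d) = ((g - r) / g) ^ CARD('d) * (2 * g) ^ CARD('d)"
    by (simp only: power_mult_distrib)
  ultimately have "(((g - r) / g) ^ CARD('d) * enn2real (mass_within K TYPE(real ^ 'd) r)) * (2 * g) ^ CARD('d)
      \<le> enn2real (box_energy K TYPE(real ^ 'd) g)"
    by (simp only: mult_ac)
  moreover have "0 < (2 * g) ^ CARD('d)"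
    using assms by simp
  ultimately show ?thesis
    unfolding mean_box_mass_def by (subst pos_le_divide_eq)
qed

lemma mean_box_mass_pos:
  assumes "0 < u" "0 < K u" "0 < g"
  shows "0 < mean_box_mass K TYPE(real ^ 'd) g"
proof -
  have "0 < enn2real (mass_within K TYPE(real ^ 'd) (g / 2))"
    using mass_within_pos[OF assms(1,2), of "g / 2", where 'a = "real ^ 'd"] fin assms
      mass_within_le[of "g / 2", where 'a = "real ^ 'd"]
    by (auto simp: enn2real_positive_iff intro: le_less_trans)
  then have "0 < ((g - g / 2) / g) ^ CARD('d) * enn2real (mass_within K TYPE(real ^ 'd) (g / 2))"
    using assms by simp
  also have "\<dots> \<le> mean_box_mass K TYPE(real ^ 'd) g"
    using assms by (intro mean_box_mass_ge) auto
  finally show ?thesis .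
qed

text \<open>The upper bound is the total mass. For the lower bound first choose \<open>r\<close> so that the mass within \<open>r\<close>
is almost total, and then let the box grow: the proportion of its points at distance at least \<open>r\<close> from
the boundary tends to one.\<close>

lemma mean_box_mass_tendsto:
  "(mean_box_mass K TYPE(real ^ 'd) \<longlongrightarrow> enn2real (total_mass K TYPE(real ^ 'd))) at_top"
proof (rule order_tendstoI)
  fix a assume a: "a < enn2real (total_mass K TYPE(real ^ 'd))"
  have "(\<lambda>n. enn2real (mass_within K TYPE(real ^ 'd) (real n))) \<longlonglongrightarrow> enn2real (total_mass K TYPE(real ^ 'd))"
  proof -
    have "incseq (\<lambda>n. mass_within K TYPE(real ^ 'd) (real n))"
      by (auto simp: incseq_def mass_within_def indicator_def intro!: nn_integral_mono)
    from LIMSEQ_SUP[OF this] show ?thesis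
      unfolding mass_within_SUP using fin by (intro tendsto_enn2real) auto
  qed
  from order_tendstoD(1)[OF this a] obtain n
    where n: "a < enn2real (mass_within K TYPE(real ^ 'd) (real n))"
    by (auto simp: eventually_sequentially)
  have "((\<lambda>g. ((g - real n) / g) ^ CARD('d) * enn2real (mass_within K TYPE(real ^ 'd) (real n)))
      \<longlongrightarrow> 1 ^ CARD('d) * enn2real (mass_within K TYPE(real ^ 'd) (real n))) at_top"
    by (intro tendsto_intros) real_asymp
  from order_tendstoD(1)[OF this, of a] n
  have "eventually (\<lambda>g. a < ((g - real n) / g) ^ CARD('d) * enn2real (mass_within K TYPE(real ^ 'd) (real n))) at_top"
    by simp
  then show "eventually (\<lambda>g. a < mean_box_mass K TYPE(real ^ 'd) g) at_top"
    using eventually_ge_at_top[of "real n"] eventually_gt_at_top[of 0]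
  proof eventually_elim
    case (elim g)
    then show ?case
      using mean_box_mass_ge[of "real n" g] by simp
  qed
next
  fix a assume "enn2real (total_mass K TYPE(real ^ 'd)) < a"
  then show "eventually (\<lambda>g. mean_box_mass K TYPE(real ^ 'd) g < a) at_top"
    by (intro eventually_mono[OF eventually_gt_at_top[of 0]] le_less_trans[OF mean_box_mass_le])
qed

end

end

section \<open>The rectangular windows\<close>

lemma mem_window:
  "x \<in> window g t \<longleftrightarrow> fst x \<in> centred_box (g t) \<and> 0 \<le> snd x \<and> snd x \<le> t / (2 * g t) ^ CARD('d)"
  for x :: "(real ^ 'd) \<times> real"
  by (cases x) (auto simp: window_def centred_box_def)

lemma window_eq: "window g t = (centred_box (g t) :: (real ^ 'd) set) \<times> {0..t / (2 * g t) ^ CARD('d)}"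
  by (simp add: window_def centred_box_def)

lemma window_borel [measurable]: "(window g t :: ((real ^ 'd) \<times> real) set) \<in> sets borel"
  unfolding window_eq borel_prod[symmetric] by (intro pair_measureI) auto

lemma nn_integral_lborel_cylinder:
  fixes \<phi> :: "'a::euclidean_space \<Rightarrow> ennreal"
  assumes [measurable]: "\<phi> \<in> borel_measurable borel" "A \<in> sets borel" and h: "0 \<le> h"
  shows "(\<integral>\<^sup>+x\<in>A \<times> {0..h}. \<phi> (fst x) \<partial>(lborel :: ('a \<times> real) measure)) = (\<integral>\<^sup>+z\<in>A. \<phi> z \<partial>lborel) * ennreal h"
proof -
  have "(\<integral>\<^sup>+x\<in>A \<times> {0..h}. \<phi> (fst x) \<partial>(lborel :: ('a \<times> real) measure))
    = (\<integral>\<^sup>+z. (\<integral>\<^sup>+r. \<phi> z * indicator A z * indicator {0..h} r \<partial>(lborel :: real measure)) \<partial>lborel)"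
    unfolding lborel_prod[symmetric]
    by (subst lborel.nn_integral_fst[symmetric]) (auto simp: indicator_times mult_ac)
  also have "\<dots> = (\<integral>\<^sup>+z\<in>A. \<phi> z \<partial>lborel) * ennreal h"
    using h by (simp add: nn_integral_cmult_indicator nn_integral_multc)
  finally show ?thesis .
qed

lemma sets_unit_rate [measurable_cong]: "sets unit_rate = sets borel"
  by (simp add: unit_rate_def)

lemma nn_integral_unit_rate:
  assumes "f \<in> borel_measurable borel" "A \<subseteq> UNIV \<times> {0..}" "A \<in> sets borel"
  shows "(\<integral>\<^sup>+x\<in>A. f x \<partial>unit_rate) = (\<integral>\<^sup>+x\<in>A. f x \<partial>lborel)"
proof -
  have "closed (UNIV \<times> {0..} :: ((real ^ 'd) \<times> real) set)"
    by (intro closed_Times) auto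
  then have "(UNIV \<times> {0..} :: ((real ^ 'd) \<times> real) set) \<in> sets borel"
    by (rule borel_closed)
  then show ?thesis
    unfolding unit_rate_def using assms
    by (subst nn_integral_density)
       (auto intro!: nn_integral_cong borel_measurable_indicator simp: indicator_def[of A] indicator_def[of "UNIV \<times> {0..}" "(_, _)"] split: if_splits)
qed

context
  fixes p :: real
begin

abbreviation half_width :: "'d::finite itself \<Rightarrow> real \<Rightarrow> real" where
  "half_width _ t \<equiv> t powr (p / real CARD('d))"

abbreviation frame :: "real \<Rightarrow> ((real ^ 'd) \<times> real) set" where
  "frame t \<equiv> window (\<lambda>t. t powr (p / real CARD('d))) t"

lemma box_volume: "0 < t \<Longrightarrow> (2 * half_width TYPE('d::finite) t) ^ CARD('d) = 2 ^ CARD('d) * t powr p"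
  using zero_less_card_finite[where 'a = 'd] by (simp add: power_mult_distrib powr_power)

lemma frame_height:
  assumes "0 < t"
  shows "t / (2 * half_width TYPE('d::finite) t) ^ CARD('d) = t powr (1 - p) / 2 ^ CARD('d)"
  using assms unfolding box_volume[OF assms] by (simp add: powr_diff)

lemma frame_eq:
  assumes "0 < t"
  shows "(frame t :: ((real ^ 'd) \<times> real) set) = centred_box (half_width TYPE('d) t) \<times> {0..t powr (1 - p) / 2 ^ CARD('d)}"
  unfolding window_eq frame_height[OF assms] ..

lemma mem_frame:
  assumes "0 < t"
  shows "x \<in> (frame t :: ((real ^ 'd) \<times> real) set) \<longleftrightarrow>
    (\<forall>i. \<bar>fst x $ i\<bar> \<le> half_width TYPE('d) t) \<and> 0 \<le> snd x \<and> snd x \<le> t powr (1 - p) / 2 ^ CARD('d)"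
  unfolding frame_eq[OF assms] by (cases x) (auto simp: mem_centred_box)

lemma frame_mono:
  assumes p: "0 \<le> p" "p \<le> 1" and "0 < s" "s \<le> t"
  shows "(frame s :: ((real ^ 'd) \<times> real) set) \<subseteq> frame t"
proof
  fix x :: "(real ^ 'd) \<times> real" assume "x \<in> frame s"
  moreover have "half_width TYPE('d) s \<le> half_width TYPE('d) t" "s powr (1 - p) / 2 ^ CARD('d) \<le> t powr (1 - p) / 2 ^ CARD('d)"
    using assms p by (auto intro!: powr_mono2 divide_right_mono)
  ultimately show "x \<in> frame t"
    using assms by (auto simp: mem_frame intro: order_trans)
qed

lemma frame_right_closed:
  assumes s: "0 < s" and x: "\<And>t. s < t \<Longrightarrow> x \<in> (frame t :: ((real ^ 'd) \<times> real) set)"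
  shows "x \<in> frame s"
proof -
  have ev: "\<forall>\<^sub>F t in at_right s. s < t" by (rule eventually_at_right_less)
  have lim: "((\<lambda>t. t powr a / c) \<longlongrightarrow> s powr a / c) (at_right s)" if "c \<noteq> 0" for a c :: real
    using s that by (intro tendsto_intros) auto
  have "\<bar>fst x $ i\<bar> \<le> half_width TYPE('d) s" for i
  proof (rule tendsto_lowerbound)
    show "((\<lambda>t. half_width TYPE('d) t) \<longlongrightarrow> half_width TYPE('d) s) (at_right s)"
      using lim[of 1] by simp
    show "\<forall>\<^sub>F t in at_right s. \<bar>fst x $ i\<bar> \<le> half_width TYPE('d) t"
      using ev by eventually_elim (use x s in \<open>simp add: mem_frame\<close>)
  qed simp
  moreover have "snd x \<le> s powr (1 - p) / 2 ^ CARD('d)"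
  proof (rule tendsto_lowerbound)
    show "((\<lambda>t. t powr (1 - p) / 2 ^ CARD('d)) \<longlongrightarrow> s powr (1 - p) / 2 ^ CARD('d)) (at_right s)"
      by (rule lim) simp
    show "\<forall>\<^sub>F t in at_right s. snd x \<le> t powr (1 - p) / 2 ^ CARD('d)"
      using ev by eventually_elim (use x s in \<open>simp add: mem_frame\<close>)
  qed simp
  moreover have "0 \<le> snd x"
    using x[of "s + 1"] s by (simp add: mem_frame)
  ultimately show ?thesis
    using s by (simp add: mem_frame)
qed

lemma emeasure_frame:
  assumes t: "0 < t"
  shows "emeasure unit_rate (frame t :: ((real ^ 'd) \<times> real) set) = ennreal t"
proof -
  let ?B = "centred_box (half_width TYPE('d) t) :: (real ^ 'd) set"
  let ?h = "t powr (1 - p) / 2 ^ CARD('d)"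
  have "emeasure unit_rate (frame t :: ((real ^ 'd) \<times> real) set)
      = (\<integral>\<^sup>+x\<in>(frame t :: ((real ^ 'd) \<times> real) set). 1 \<partial>unit_rate)"
    by (simp add: sets_unit_rate)
  also have "\<dots> = (\<integral>\<^sup>+x\<in>(frame t :: ((real ^ 'd) \<times> real) set). 1 \<partial>lborel)"
    by (rule nn_integral_unit_rate) (auto simp: mem_window)
  also have "\<dots> = (\<integral>\<^sup>+z\<in>?B. 1 \<partial>lborel) * ennreal ?h"
    unfolding frame_eq[OF t] by (rule nn_integral_lborel_cylinder) auto
  also have "\<dots> = ennreal ((2 * half_width TYPE('d) t) ^ CARD('d)) * ennreal ?h"
    by (simp add: emeasure_centred_box)
  also have "\<dots> = ennreal t"
    using t unfolding box_volume[OF t] by (simp add: powr_diff flip: ennreal_mult)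
  finally show ?thesis .
qed

context
  fixes K :: "real \<Rightarrow> real"
  assumes K_antimono: "antimono_on {0..} K"
begin

text \<open>The kernel does not depend on the auxiliary coordinates, so each of the two points contributes the
height of the window as a factor.\<close>

lemma frame_energy:
  assumes t: "0 < t"
  shows "(\<integral>\<^sup>+x\<in>frame t. (\<integral>\<^sup>+y\<in>frame t. ennreal (K (norm (fst x - fst y :: real ^ 'd))) \<partial>unit_rate) \<partial>unit_rate)
    = (ennreal (t powr (1 - p) / 2 ^ CARD('d)))\<^sup>2 * box_energy K TYPE(real ^ 'd) (half_width TYPE('d) t)"
proof -
  note [measurable] = K_norm_measurable[OF K_antimono]
  let ?B = "centred_box (half_width TYPE('d) t) :: (real ^ 'd) set"
  define h where "h = t powr (1 - p) / 2 ^ CARD('d)"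
  have h: "0 \<le> h" by (simp add: h_def)
  note frame = frame_eq[OF t, where 'd = 'd, folded h_def]
  have sub: "?B \<times> {0..h} \<subseteq> UNIV \<times> {0..}" by auto
  have Bh: "?B \<times> {0..h} \<in> sets borel"
    using window_borel unfolding frame[symmetric] .
  define \<phi> where "\<phi> z = (\<integral>\<^sup>+z'\<in>?B. ennreal (K (norm (z - z'))) \<partial>lborel)" for z :: "real ^ 'd"
  have \<phi>_meas: "\<phi> \<in> borel_measurable borel"
    unfolding \<phi>_def by measurable
  have inner: "(\<integral>\<^sup>+y\<in>frame t. ennreal (K (norm (z - fst y :: real ^ 'd))) \<partial>unit_rate) = \<phi> z * ennreal h" for z
  proof -
    have "(\<lambda>y. z - fst y) \<in> borel_measurable (borel :: ((real ^ 'd) \<times> real) measure)"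
      by (intro borel_measurable_continuous_onI continuous_intros)
    then have "(\<lambda>y. ennreal (K (norm (z - fst y)))) \<in> borel_measurable (borel :: ((real ^ 'd) \<times> real) measure)"
      by measurable
    then show ?thesis
      unfolding frame \<phi>_def using sub Bh h
      by (subst nn_integral_unit_rate) (auto intro!: nn_integral_lborel_cylinder)
  qed
  have "(\<integral>\<^sup>+x\<in>frame t. (\<integral>\<^sup>+y\<in>frame t. ennreal (K (norm (fst x - fst y :: real ^ 'd))) \<partial>unit_rate) \<partial>unit_rate)
    = (\<integral>\<^sup>+x\<in>?B \<times> {0..h}. \<phi> (fst x) * ennreal h \<partial>unit_rate)"
    unfolding inner unfolding frame ..
  also have "\<dots> = (\<integral>\<^sup>+x\<in>?B \<times> {0..h}. \<phi> (fst x) * ennreal h \<partial>lborel)"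
  proof (rule nn_integral_unit_rate[OF _ sub Bh])
    have "fst \<in> borel_measurable (borel :: ((real ^ 'd) \<times> real) measure)"
      by (intro borel_measurable_continuous_onI continuous_intros)
    from measurable_compose[OF this \<phi>_meas]
    show "(\<lambda>x :: (real ^ 'd) \<times> real. \<phi> (fst x) * ennreal h) \<in> borel_measurable borel"
      by (rule borel_measurable_times_ennreal) simp
  qed
  also have "\<dots> = (\<integral>\<^sup>+z\<in>?B. \<phi> z * ennreal h \<partial>lborel) * ennreal h"
    using \<phi>_meas h by (intro nn_integral_lborel_cylinder) auto
  also have "(\<integral>\<^sup>+z\<in>?B. \<phi> z * ennreal h \<partial>lborel) = (\<integral>\<^sup>+z\<in>?B. \<phi> z \<partial>lborel) * ennreal h"
    using \<phi>_meas by (subst nn_integral_multc[symmetric]) (auto simp: mult_ac)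
  finally show ?thesis
    by (simp add: box_energy_def \<phi>_def h_def power2_eq_square mult_ac)
qed

end

end

section \<open>Edges of the model and the sparsity rate\<close>

lemma expected_edge_count:
  assumes "prob_space M"
    and irrefl: "\<And>\<omega> i. \<omega> \<in> space M \<Longrightarrow> \<not> G \<omega> i i"
    and meas: "\<And>i j. 1 \<le> i \<Longrightarrow> 1 \<le> j \<Longrightarrow> {\<omega> \<in> space M. G \<omega> i j} \<in> sets M"
  shows "(\<integral>\<omega>. (\<Sum>i=1..n. \<Sum>j=1..n. adjacency G n \<omega> i j) / c \<partial>M)
    = (\<Sum>(i, j)\<in>distinct_pairs {1..n}. measure M {\<omega> \<in> space M. G \<omega> i j}) / c"
proof -
  interpret prob_space M by fact
  let ?A = "\<lambda>(i, j). {\<omega> \<in> space M. G \<omega> i j}"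
  have "(\<Sum>i=1..n. \<Sum>j=1..n. adjacency G n \<omega> i j)
      = (\<Sum>z\<in>distinct_pairs {1..n}. indicator (?A z) \<omega>)" if "\<omega> \<in> space M" for \<omega>
  proof -
    have "(\<Sum>i=1..n. \<Sum>j=1..n. adjacency G n \<omega> i j) = (\<Sum>(i, j)\<in>{1..n} \<times> {1..n}. adjacency G n \<omega> i j)"
      by (rule sum.cartesian_product)
    also have "\<dots> = (\<Sum>(i, j)\<in>distinct_pairs {1..n}. adjacency G n \<omega> i j)"
      using irrefl[OF that]
      by (intro sum.mono_neutral_right) (auto simp: distinct_pairs_def adjacency_def)
    also have "\<dots> = (\<Sum>z\<in>distinct_pairs {1..n}. indicator (?A z) \<omega>)"
      using that by (intro sum.cong) (auto simp: distinct_pairs_def adjacency_def indicator_def)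
    finally show ?thesis .
  qed
  then have "(\<integral>\<omega>. (\<Sum>i=1..n. \<Sum>j=1..n. adjacency G n \<omega> i j) / c \<partial>M)
      = (\<integral>\<omega>. (\<Sum>z\<in>distinct_pairs {1..n}. indicator (?A z) \<omega>) / c \<partial>M)"
    by (intro Bochner_Integration.integral_cong) auto
  also have "\<dots> = (\<Sum>z\<in>distinct_pairs {1..n}. measure M (?A z)) / c"
  proof -
    have "?A z \<in> sets M" if "z \<in> distinct_pairs {1..n}" for z
      using that meas by (cases z) (auto simp: distinct_pairs_def)
    then show ?thesis
      by (subst integral_divide_zero, subst Bochner_Integration.integral_sum)
         (auto simp: Int_absorb2 sets.sets_into_space emeasure_eq_measure intro!: sum.cong)
  qed
  finally show ?thesis
    by (simp add: case_prod_beta)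
qed

text \<open>The edge probability is the mean of \<open>K(\<parallel>Z\<^sub>i - Z\<^sub>j\<parallel>)\<close> in the following sense: the conditional
probability of the edge is a genuinely measurable version \<open>Z\<close> of this variable. The model prescribes the
conditional probabilities for increasing pairs of indices, and the symmetry of the graph gives the
others.\<close>

lemma LPM_edge_probability:
  assumes LPM: "rectangular_LPM M g K \<Psi> G" and ij: "1 \<le> i" "1 \<le> j" "i \<noteq> j"
  obtains Z where "integrable M Z" "(\<integral>\<omega>. Z \<omega> \<partial>M) = measure M {\<omega> \<in> space M. G \<omega> i j}"
    "AE \<omega> in M. Z \<omega> = K (norm (latent_position g (\<Psi> \<omega>) i - latent_position g (\<Psi> \<omega>) j))"
proof -
  interpret prob_space M using LPM by (simp add: rectangular_LPM_def)
  define F where "F = vimage_algebra (space M) \<Psi> configurations"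
  have \<Psi>: "\<Psi> \<in> M \<rightarrow>\<^sub>M configurations"
    using LPM by (simp add: rectangular_LPM_def poisson_process_def)
  have "subalgebra M F"
    unfolding subalgebra_def F_def
    using \<Psi> by (auto simp: sets_vimage_algebra2 measurable_def)
  then interpret finite_measure_subalgebra M F
    by unfold_locales
  (* Conditional edge probabilities are given for increasing pairs of indices. *)
  define a b where "a = min i j" and "b = max i j"
  define A where "A = {\<omega> \<in> space M. G \<omega> i j}"
  have sym: "G \<omega> a b \<longleftrightarrow> G \<omega> i j" if "\<omega> \<in> space M" for \<omega>
    using LPM that unfolding rectangular_LPM_def a_def b_def by (metis max_def min_def)
  have A: "A \<in> sets M"
    using LPM ij unfolding rectangular_LPM_def A_def by blast
  have cond: "AE \<omega> in M. real_cond_exp M F (indicator {\<omega> \<in> space M. \<forall>(i, j)\<in>E. G \<omega> i j}) \<omega>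
      = (\<Prod>(i, j)\<in>E. K (norm (latent_position g (\<Psi> \<omega>) i - latent_position g (\<Psi> \<omega>) j)))"
    if "finite E" "E \<subseteq> {(i, j). 1 \<le> i \<and> i < j}" for E
    using LPM that unfolding rectangular_LPM_def F_def by blast
  have "{(a, b)} \<subseteq> {(i, j). 1 \<le> i \<and> i < j}"
    using ij by (auto simp: a_def b_def)
  moreover have "{\<omega> \<in> space M. \<forall>(i, j)\<in>{(a, b)}. G \<omega> i j} = A"
    using sym by (auto simp: A_def)
  ultimately have "AE \<omega> in M. real_cond_exp M F (indicator A) \<omega>
      = (\<Prod>(i, j)\<in>{(a, b)}. K (norm (latent_position g (\<Psi> \<omega>) i - latent_position g (\<Psi> \<omega>) j)))"
    using cond[of "{(a, b)}"] by simp
  then have "AE \<omega> in M. real_cond_exp M F (indicator A) \<omega>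
      = K (norm (latent_position g (\<Psi> \<omega>) i - latent_position g (\<Psi> \<omega>) j))"
    by (auto elim!: eventually_mono simp: a_def b_def min_def max_def norm_minus_commute)
  moreover have "integrable M (indicator A :: _ \<Rightarrow> real)"
    using A by (simp add: less_top[symmetric])
  ultimately show ?thesis
    using A real_cond_exp_int[of "indicator A"] by (intro that[of "real_cond_exp M F (indicator A)"]) (auto simp: A_def)
qed

lemma poisson_arrivals_frame:
  assumes "0 \<le> p" "p \<le> 1"
    and "poisson_process M unit_rate (\<Psi> :: 'w \<Rightarrow> ((real ^ 'd) \<times> real) set)"
  shows "poisson_arrivals (window (\<lambda>t. t powr (p / real CARD('d)))) M unit_rate \<Psi>"
proof (unfold_locales)
  fix s t :: real
  assume "0 < s" "s \<le> t"
  then show "(window (\<lambda>t. t powr (p / real CARD('d))) s :: ((real ^ 'd) \<times> real) set) \<subseteq> window (\<lambda>t. t powr (p / real CARD('d))) t"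
    by (rule frame_mono[OF assms(1,2)])
next
  fix s :: real and x :: "(real ^ 'd) \<times> real"
  assume "0 < s" "\<And>t. s < t \<Longrightarrow> x \<in> window (\<lambda>t. t powr (p / real CARD('d))) t"
  then show "x \<in> window (\<lambda>t. t powr (p / real CARD('d))) s"
    by (rule frame_right_closed)
qed (use assms in \<open>auto simp: sets_unit_rate intro: emeasure_frame\<close>)

lemma numbered_window:
  fixes \<phi> :: "((real ^ 'd) \<times> real) set"
  assumes "observation_windows (window g :: real \<Rightarrow> ((real ^ 'd) \<times> real) set)"
  shows "observation_windows.numbered (window g) \<phi> i = node g \<phi> i"
  unfolding observation_windows.numbered_def[OF assms] observation_windows.entry_def[OF assms]
    node_def arrives_def arrival_time_def ..

text \<open>For \<open>p = 0\<close> the half-width is constantly one; for \<open>p > 0\<close> it tends to infinity. The limit is positive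
since \<open>K\<close> is bounded below by a positive constant near \<open>0\<close>: otherwise \<open>K \<le> 0\<close> on \<open>{0<..}\<close>, against
the positivity of its integral.\<close>

lemma mean_box_mass_limit:
  fixes p :: real and K :: "real \<Rightarrow> real"
  assumes p: "0 \<le> p" "p \<le> 1"
    and K_range: "\<And>u. 0 \<le> u \<Longrightarrow> K u \<in> {0..1}"
    and K_antimono: "antimono_on {0..} K"
    and pos: "0 < (\<integral>\<^sup>+u\<in>{0..}. ennreal (u ^ (CARD('d) - 1) * K u) \<partial>lborel)"
    and fin: "(\<integral>\<^sup>+u\<in>{0..}. ennreal (u ^ (CARD('d) - 1) * K u) \<partial>lborel) < \<infinity>"
  obtains C where "0 < C"
    "((\<lambda>t. mean_box_mass K TYPE(real ^ 'd::finite) (half_width p TYPE('d) t)) \<longlongrightarrow> C) at_top"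
proof -
  have total: "total_mass K TYPE(real ^ 'd) < \<infinity>"
    using total_mass_finite[OF K_antimono, where 'a = "real ^ 'd"] K_range fin by simp
  have "\<exists>u>0. 0 < K u"
  proof (rule ccontr)
    assume "\<not> (\<exists>u>0. 0 < K u)"
    then have le: "K u \<le> 0" if "0 < u" for u using that by (meson not_le)
    have "AE u in lborel. ennreal (u ^ (CARD('d) - 1) * K u) * indicator {0..} u = 0"
      using AE_lborel_singleton[of 0]
      by eventually_elim (use le in \<open>auto simp: indicator_def intro!: ennreal_neg mult_nonneg_nonpos\<close>)
    then have "(\<integral>\<^sup>+u\<in>{0..}. ennreal (u ^ (CARD('d) - 1) * K u) \<partial>lborel) = (\<integral>\<^sup>+u. 0 \<partial>(lborel :: real measure))"
      by (rule nn_integral_cong_AE)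
    with pos show False by simp
  qed
  then obtain u where u: "0 < u" "0 < K u" by blast
  note box_mass_pos = mean_box_mass_pos[OF K_antimono total u]
  show ?thesis
  proof (cases "p = 0")
    case True
    have "((\<lambda>t. mean_box_mass K TYPE(real ^ 'd) (half_width p TYPE('d) t)) \<longlongrightarrow> mean_box_mass K TYPE(real ^ 'd) 1) at_top"
      by (rule tendsto_eventually, rule eventually_mono[OF eventually_gt_at_top[of 0]]) (simp add: True)
    then show ?thesis
      using box_mass_pos[of 1] by (intro that) auto
  next
    case False
    then have "0 < p / real CARD('d)"
      using p zero_less_card_finite[where 'a = 'd] by simp
    then have "filterlim (half_width p TYPE('d)) at_top at_top"
      by real_asymp
    from filterlim_compose[OF mean_box_mass_tendsto[OF K_antimono total] this] show ?thesis
    proof (rule that[rotated])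
      have "0 < mean_box_mass K TYPE(real ^ 'd) 1" by (rule box_mass_pos) simp_all
      also have "\<dots> \<le> enn2real (total_mass K TYPE(real ^ 'd))"
        by (rule mean_box_mass_le[OF K_antimono total]) simp_all
      finally show "0 < enn2real (total_mass K TYPE(real ^ 'd))" .
    qed
  qed
qed

text \<open>The factor \<open>\<theta> powr \<alpha>\<close> by which the two bounds miss \<open>C\<close> is continuous at \<open>\<theta> = 1\<close>, so each of them can
be brought to the right side of any prescribed level by fixing one \<open>\<theta>\<close> before \<open>n\<close> tends to infinity.\<close>

lemma sandwich_tendsto:
  fixes a :: "nat \<Rightarrow> real" and f :: "real \<Rightarrow> real" and q :: "real \<Rightarrow> real"
  assumes f: "((\<lambda>t. f t / t powr \<alpha>) \<longlongrightarrow> C) at_top"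
    and q: "\<And>\<theta>. 0 < \<theta> \<Longrightarrow> \<theta> \<noteq> 1 \<Longrightarrow> 0 < q \<theta> \<and> q \<theta> < 1"
    and upper: "\<And>\<theta>. 1 < \<theta> \<Longrightarrow> \<forall>\<^sub>F n in sequentially. a n \<le> f (\<theta> * real n) + (real n)\<^sup>2 * q \<theta> ^ n"
    and lower: "\<And>\<theta>. 0 < \<theta> \<Longrightarrow> \<theta> < 1 \<Longrightarrow> \<forall>\<^sub>F n in sequentially. f (\<theta> * real n) \<le> a n + (real n)\<^sup>2 * q \<theta> ^ n"
  shows "(\<lambda>n. a n / real n powr \<alpha>) \<longlonglongrightarrow> C"
proof -
  have err: "(\<lambda>n. (real n)\<^sup>2 * r ^ n / real n powr \<alpha>) \<longlonglongrightarrow> 0" if "0 < r" "r < 1" for r :: real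
    using that by real_asymp
  have main: "(\<lambda>n. f (\<theta> * real n) / real n powr \<alpha>) \<longlonglongrightarrow> \<theta> powr \<alpha> * C" if "0 < \<theta>" for \<theta>
  proof -
    have "filterlim (\<lambda>n. \<theta> * real n) at_top sequentially"
      using that by real_asymp
    from filterlim_compose[OF f this]
    have "(\<lambda>n. \<theta> powr \<alpha> * (f (\<theta> * real n) / (\<theta> * real n) powr \<alpha>)) \<longlonglongrightarrow> \<theta> powr \<alpha> * C"
      by (intro tendsto_intros)
    moreover have "\<theta> powr \<alpha> * (f (\<theta> * real n) / (\<theta> * real n) powr \<alpha>) = f (\<theta> * real n) / real n powr \<alpha>" for n
      using that by (simp add: powr_mult)
    ultimately show ?thesis by simp
  qed
  have cont: "((\<lambda>\<theta>. \<theta> powr \<alpha> * C) \<longlongrightarrow> C) (at 1)"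
    by (rule tendsto_eq_rhs, (rule tendsto_intros | simp)+)
  show ?thesis
  proof (rule order_tendstoI)
    fix u assume "C < u"
    have "\<forall>\<^sub>F \<theta> in at_right 1. \<theta> powr \<alpha> * C < u"
      using order_tendstoD(2)[OF cont \<open>C < u\<close>] by (simp add: eventually_at_split)
    then have "\<forall>\<^sub>F \<theta> in at_right 1. \<theta> powr \<alpha> * C < u \<and> 1 < \<theta>"
      using eventually_at_right_less[of 1] by (rule eventually_conj)
    then obtain \<theta> where \<theta>: "\<theta> powr \<alpha> * C < u" "1 < \<theta>"
      using eventually_happens by fastforce
    have "(\<lambda>n. f (\<theta> * real n) / real n powr \<alpha> + (real n)\<^sup>2 * q \<theta> ^ n / real n powr \<alpha>) \<longlonglongrightarrow> \<theta> powr \<alpha> * C + 0"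
      using \<theta> q[of \<theta>] by (intro tendsto_add main err) auto
    then have "\<forall>\<^sub>F n in sequentially. f (\<theta> * real n) / real n powr \<alpha> + (real n)\<^sup>2 * q \<theta> ^ n / real n powr \<alpha> < u"
      using \<theta> by (intro order_tendstoD(2)) auto
    with upper[OF \<theta>(2)] eventually_gt_at_top[of 0]
    show "\<forall>\<^sub>F n in sequentially. a n / real n powr \<alpha> < u"
    proof eventually_elim
      case (elim n)
      then have "a n / real n powr \<alpha> \<le> (f (\<theta> * real n) + (real n)\<^sup>2 * q \<theta> ^ n) / real n powr \<alpha>"
        by (intro divide_right_mono) auto
      with elim show ?case by (simp add: add_divide_distrib)
    qed
  next
    fix u assume "u < C"
    have "\<forall>\<^sub>F \<theta> in at_left 1. u < \<theta> powr \<alpha> * C"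
      using order_tendstoD(1)[OF cont \<open>u < C\<close>] by (simp add: eventually_at_split)
    moreover have "\<forall>\<^sub>F \<theta> in at_left 1. \<theta> \<in> {0<..<1 :: real}"
      by (rule eventually_at_left_real) simp
    ultimately have "\<forall>\<^sub>F \<theta> in at_left 1. u < \<theta> powr \<alpha> * C \<and> \<theta> \<in> {0<..<1}"
      by (rule eventually_conj)
    then obtain \<theta> where \<theta>: "u < \<theta> powr \<alpha> * C" "0 < \<theta>" "\<theta> < 1"
      using eventually_happens by fastforce
    have "(\<lambda>n. f (\<theta> * real n) / real n powr \<alpha> - (real n)\<^sup>2 * q \<theta> ^ n / real n powr \<alpha>) \<longlonglongrightarrow> \<theta> powr \<alpha> * C - 0"
      using \<theta> q[of \<theta>] by (intro tendsto_diff main err) auto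
    then have "\<forall>\<^sub>F n in sequentially. u < f (\<theta> * real n) / real n powr \<alpha> - (real n)\<^sup>2 * q \<theta> ^ n / real n powr \<alpha>"
      using \<theta> by (intro order_tendstoD(1)) auto
    with lower[OF \<theta>(2,3)] eventually_gt_at_top[of 0]
    show "\<forall>\<^sub>F n in sequentially. u < a n / real n powr \<alpha>"
    proof eventually_elim
      case (elim n)
      then have "f (\<theta> * real n) / real n powr \<alpha> \<le> (a n + (real n)\<^sup>2 * q \<theta> ^ n) / real n powr \<alpha>"
        by (intro divide_right_mono) auto
      with elim show ?case by (simp add: add_divide_distrib)
    qed
  qed
qed

lemma mult_exp_less_1:
  fixes \<theta> :: real
  assumes "0 < \<theta>" "\<theta> \<noteq> 1"
  shows "0 < \<theta> * exp (1 - \<theta>) \<and> \<theta> * exp (1 - \<theta>) < 1"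
proof -
  have "ln \<theta> < \<theta> - 1"
    using assms ln_le_minus_one[of \<theta>] ln_eq_minus_one[of \<theta>] by force
  then have "exp (ln \<theta> + (1 - \<theta>)) < 1" by simp
  then show ?thesis using assms by (simp add: exp_add)
qed

theorem theorem2:
  fixes p :: real and K :: "real \<Rightarrow> real"
    and M :: "'w measure"
    and \<Psi> :: "'w \<Rightarrow> ((real ^ 'd) \<times> real) set"
    and G :: "'w \<Rightarrow> nat \<Rightarrow> nat \<Rightarrow> bool"
  assumes "0 \<le> p" and "p \<le> 1"
    and "\<And>u. 0 \<le> u \<Longrightarrow> K u \<in> {0..1}"
    and "antimono_on {0..} K"
    and "0 < (\<integral>\<^sup>+u\<in>{0..}. ennreal (u ^ (CARD('d) - 1) * K u) \<partial>lborel)"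
    and "(\<integral>\<^sup>+u\<in>{0..}. ennreal (u ^ (CARD('d) - 1) * K u) \<partial>lborel) < \<infinity>"
    and "rectangular_LPM M (\<lambda>t. t powr (p / real CARD('d))) K \<Psi> G"
  shows "sparse_in_expectation M (adjacency G) (\<lambda>n. real n powr (2 - p))"
proof -
  let ?g = "\<lambda>t. t powr (p / real CARD('d))"
  note LPM = assms(7)
  have poisson: "poisson_process M unit_rate \<Psi>" and prob: "prob_space M"
    using LPM by (simp_all add: rectangular_LPM_def)
  interpret prob_space M by (rule prob)
  interpret poisson_arrivals "window ?g" M unit_rate \<Psi>
    using assms(1,2) poisson by (rule poisson_arrivals_frame)
  have total: "total_mass K TYPE(real ^ 'd) < \<infinity>"
    using total_mass_finite[OF assms(4), where 'a = "real ^ 'd"] assms(3,6) by simp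
  obtain C where C: "0 < C" and lim:
    "((\<lambda>t. mean_box_mass K TYPE(real ^ 'd) (half_width p TYPE('d) t)) \<longlongrightarrow> C) at_top"
    using mean_box_mass_limit[OF assms(1-6)] by blast

  define F where "F x y = K (norm (fst x - fst y))" for x y :: "(real ^ 'd) \<times> real"
  have F: "0 \<le> F x y" "F x y \<le> 1" for x y
    using assms(3)[of "norm (fst x - fst y)"] by (auto simp: F_def)
  have F_meas: "(\<lambda>(x, y). F x y) \<in> borel_measurable (unit_rate \<Otimes>\<^sub>M unit_rate)"
  proof -
    have "(\<lambda>z :: ((real ^ 'd) \<times> real) \<times> ((real ^ 'd) \<times> real). fst (fst z) - fst (snd z)) \<in> borel_measurable borel"
      by (intro borel_measurable_continuous_onI continuous_intros)
    from measurable_compose[OF this K_norm_measurable[OF assms(4)]]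
    have "(\<lambda>(x, y). F x y) \<in> borel_measurable borel"
      by (simp add: F_def case_prod_beta)
    moreover have "sets (unit_rate \<Otimes>\<^sub>M unit_rate) = sets (borel :: (((real ^ 'd) \<times> real) \<times> ((real ^ 'd) \<times> real)) measure)"
      using sets_pair_measure_cong[OF sets_unit_rate sets_unit_rate] by (simp only: borel_prod)
    ultimately show ?thesis
      by (simp cong: measurable_cong_sets)
  qed

  (* The mean of the pair sum over the window at time t. *)
  define f where "f t = t powr (2 - p) / 2 ^ CARD('d) * mean_box_mass K TYPE(real ^ 'd) (half_width p TYPE('d) t)" for t
  have f_nonneg: "0 \<le> f t" for t
    by (simp add: f_def mean_box_mass_def)
  have energy: "(\<integral>\<^sup>+x\<in>window ?g t. (\<integral>\<^sup>+y\<in>window ?g t. ennreal (F x y) \<partial>unit_rate) \<partial>unit_rate) = ennreal (f t)"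
    if t: "0 < t" for t
  proof -
    define m where "m = mean_box_mass K TYPE(real ^ 'd) (half_width p TYPE('d) t)"
    have "box_energy K TYPE(real ^ 'd) (half_width p TYPE('d) t)
        = ennreal (enn2real (box_energy K TYPE(real ^ 'd) (half_width p TYPE('d) t)))"
      using box_energy_finite[OF assms(4) total, of "half_width p TYPE('d) t"] by simp
    also have "enn2real (box_energy K TYPE(real ^ 'd) (half_width p TYPE('d) t)) = m * (2 * half_width p TYPE('d) t) ^ CARD('d)"
      using t by (simp add: m_def mean_box_mass_def)
    also have "\<dots> = m * (2 ^ CARD('d) * t powr p)"
      using box_volume[OF t, where 'd = 'd] by simp
    finally have box: "box_energy K TYPE(real ^ 'd) (half_width p TYPE('d) t) = ennreal (m * (2 ^ CARD('d) * t powr p))" .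
    have m: "0 \<le> m" by (simp add: m_def mean_box_mass_def)
    have "(\<integral>\<^sup>+x\<in>window ?g t. (\<integral>\<^sup>+y\<in>window ?g t. ennreal (F x y) \<partial>unit_rate) \<partial>unit_rate)
      = (ennreal (t powr (1 - p) / 2 ^ CARD('d)))\<^sup>2 * box_energy K TYPE(real ^ 'd) (half_width p TYPE('d) t)"
      unfolding F_def by (rule frame_energy[OF assms(4) t])
    also have "\<dots> = ennreal ((t powr (1 - p) / 2 ^ CARD('d))\<^sup>2 * (m * (2 ^ CARD('d) * t powr p)))"
      unfolding box using m by (simp add: ennreal_power flip: ennreal_mult)
    also have "(t powr (1 - p) / 2 ^ CARD('d))\<^sup>2 * (m * (2 ^ CARD('d) * t powr p)) = t powr (2 - p) / 2 ^ CARD('d) * m"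
      using t by (simp add: power2_eq_square powr_diff field_simps)
    finally show ?thesis by (simp only: f_def m_def)
  qed

  define a where "a n = (\<Sum>(i, j)\<in>distinct_pairs {1..n}. measure M {\<omega> \<in> space M. G \<omega> i j})" for n
  have bounds: "1 < \<theta> \<Longrightarrow> a n \<le> f (\<theta> * real n) + (real n)\<^sup>2 * (\<theta> * exp (1 - \<theta>)) ^ n"
    "\<theta> < 1 \<Longrightarrow> 2 \<le> real n * ln (1 / \<theta>) \<Longrightarrow> f (\<theta> * real n) \<le> a n + (real n)\<^sup>2 * (\<theta> * exp (1 - \<theta>)) ^ n"
    if \<theta>: "0 < \<theta>" and n: "0 < n" for \<theta> n
  proof -
    (* Z i j is a measurable version of the link probability of the i-th and j-th node. *)
    define edge_version where "edge_version i j Z \<longleftrightarrow> integrable M Z \<and>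
        (\<integral>\<omega>. Z \<omega> \<partial>M) = measure M {\<omega> \<in> space M. G \<omega> i j} \<and>
        (AE \<omega> in M. Z \<omega> = F (numbered (\<Psi> \<omega>) i) (numbered (\<Psi> \<omega>) j))" for i j Z
    have "\<exists>Z. edge_version i j Z" if "(i, j) \<in> distinct_pairs {1..n}" for i j
    proof -
      have "1 \<le> i" "1 \<le> j" "i \<noteq> j"
        using that by (auto simp: distinct_pairs_def)
      from LPM_edge_probability[OF LPM this] show ?thesis
        by (auto simp: edge_version_def F_def numbered_window[OF observation_windows_axioms] latent_position_def)
    qed
    then obtain Z where Z: "edge_version i j (Z i j)" if "(i, j) \<in> distinct_pairs {1..n}" for i j
      by metis
    define V where "V \<omega> = (\<Sum>(i, j)\<in>distinct_pairs {1..n}. Z i j \<omega>)" for \<omega>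
    have V_int: "integrable M V"
      unfolding V_def using Z by (intro Bochner_Integration.integrable_sum) (auto simp: edge_version_def)
    have V_mean: "(\<integral>\<omega>. V \<omega> \<partial>M) = a n"
      unfolding V_def a_def using Z
      by (subst Bochner_Integration.integral_sum) (auto simp: edge_version_def intro!: sum.cong)
    have "AE \<omega> in M. \<forall>z\<in>distinct_pairs {1..n}. Z (fst z) (snd z) \<omega> = F (numbered (\<Psi> \<omega>) (fst z)) (numbered (\<Psi> \<omega>) (snd z))"
      using Z by (intro AE_finite_allI finite_distinct_pairs) (auto simp: edge_version_def)
    then have V_eq: "AE \<omega> in M. V \<omega> = pair_sum F n (\<Psi> \<omega>)"
      by eventually_elim (auto simp: V_def pair_sum_def intro!: sum.cong)
    then have "AE \<omega> in M. 0 \<le> V \<omega>"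
      by eventually_elim (simp add: pair_sum_nonneg F)
    then have V_nn: "(\<integral>\<^sup>+\<omega>. ennreal (V \<omega>) \<partial>M) = ennreal (a n)"
      using nn_integral_eq_integral[OF V_int] V_mean by simp
    have t: "0 < \<theta> * real n" using \<theta> n by simp
    have a_nonneg: "0 \<le> a n"
      unfolding a_def by (intro sum_nonneg) auto
    have err: "0 \<le> (real n)\<^sup>2 * (\<theta> * exp (1 - \<theta>)) ^ n"
      using \<theta> by simp
    note main = expected_pair_sum_bounds[OF F F_meas _ V_eq \<theta> n, unfolded V_nn energy[OF t]]
    show "a n \<le> f (\<theta> * real n) + (real n)\<^sup>2 * (\<theta> * exp (1 - \<theta>)) ^ n" if "1 < \<theta>"
      using main(1)[OF _ that] V_int err f_nonneg by (simp flip: ennreal_plus)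
    show "f (\<theta> * real n) \<le> a n + (real n)\<^sup>2 * (\<theta> * exp (1 - \<theta>)) ^ n" if "\<theta> < 1" "2 \<le> real n * ln (1 / \<theta>)"
      using main(2)[OF _ that] V_int err a_nonneg by (simp flip: ennreal_plus)
  qed

  have "(\<lambda>n. a n / real n powr (2 - p)) \<longlonglongrightarrow> C / 2 ^ CARD('d)"
  proof (rule sandwich_tendsto[where f = f and q = "\<lambda>\<theta>. \<theta> * exp (1 - \<theta>)"])
    have "((\<lambda>t. mean_box_mass K TYPE(real ^ 'd) (half_width p TYPE('d) t) / 2 ^ CARD('d)) \<longlongrightarrow> C / 2 ^ CARD('d)) at_top"
      using lim by (intro tendsto_divide) auto
    moreover have "\<forall>\<^sub>F t in at_top. mean_box_mass K TYPE(real ^ 'd) (half_width p TYPE('d) t) / 2 ^ CARD('d) = f t / t powr (2 - p)"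
      using eventually_gt_at_top[of 0] by eventually_elim (simp add: f_def)
    ultimately show "((\<lambda>t. f t / t powr (2 - p)) \<longlongrightarrow> C / 2 ^ CARD('d)) at_top"
      by (rule Lim_transform_eventually)
    show "\<forall>\<^sub>F n in sequentially. a n \<le> f (\<theta> * real n) + (real n)\<^sup>2 * (\<theta> * exp (1 - \<theta>)) ^ n" if "1 < \<theta>" for \<theta>
      using eventually_gt_at_top[of 0] by eventually_elim (use that bounds(1) in auto)
    show "\<forall>\<^sub>F n in sequentially. f (\<theta> * real n) \<le> a n + (real n)\<^sup>2 * (\<theta> * exp (1 - \<theta>)) ^ n"
      if \<theta>: "0 < \<theta>" "\<theta> < 1" for \<theta>
    proof -
      have "0 < ln (1 / \<theta>)" using \<theta> by simp
      then have "filterlim (\<lambda>n. real n * ln (1 / \<theta>)) at_top sequentially"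
        by real_asymp
      then have "\<forall>\<^sub>F n in sequentially. 2 \<le> real n * ln (1 / \<theta>)"
        by (simp add: filterlim_at_top)
      with eventually_gt_at_top[of 0] show ?thesis
        by eventually_elim (use \<theta> bounds(2) in auto)
    qed
  qed (use mult_exp_less_1 in auto)
  then have "(\<lambda>n. \<integral>\<omega>. (\<Sum>i=1..n. \<Sum>j=1..n. adjacency G n \<omega> i j) / real n powr (2 - p) \<partial>M) \<longlonglongrightarrow> C / 2 ^ CARD('d)"
  proof (rule Lim_transform_eventually, intro always_eventually allI)
    fix n
    show "a n / real n powr (2 - p) = (\<integral>\<omega>. (\<Sum>i=1..n. \<Sum>j=1..n. adjacency G n \<omega> i j) / real n powr (2 - p) \<partial>M)"
      unfolding a_def using LPM prob
      by (intro expected_edge_count[symmetric]) (auto simp: rectangular_LPM_def)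
  qed
  moreover have "0 < C / 2 ^ CARD('d)"
    using C by simp
  ultimately show ?thesis
    unfolding sparse_in_expectation_def by blast
qed

end
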